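(* Let $\alpha\in(0,1]$, $F\in C^{1,\alpha}_{\mathsf h}(\mathbb H,\mathbb R^2)$, and let $p\in\mathbb H$ be nondegenerate for $F$. Then there exist $\delta_0,\varepsilon_0,\varrho_0>0$ such that for every $q\in B(p,\varepsilon_0)$ there is an injective solution $\gamma:[-\delta_0,\delta_0]\to\mathbb H$ to the LSDE associated to $F$ and $p$ with $\gamma_0=q$, $$\|\gamma^{\mathsf h}\|_{\frac{1+\alpha}{2}}\le\varrho_0\quad\text{and}\quad \|\mathbb E\|\le\kappa\|\gamma^{\mathsf h}\|_{\frac{1+\alpha}2}^2\le\kappa\varrho_0^2 .$$
   Context: The Heisenberg group $\mathbb H$ is $\mathbb R^3$ with product $(x^1,x^2,x^3)(y^1,y^2,y^3)=(x^1+y^1,x^2+y^2,x^3+y^3+x^1y^2-x^2y^1)$ (identity $0$, inverse $x^{-1}=-x$). For $x\in\mathbb H$ write $x^{\mathsf h}=(x^1,x^2)\in\mathbb R^2$, $x^{\mathsf v}=x^3$, $[x]^{\mathsf h}=|x^{\mathsf h}|$, $[x]^{\mathsf v}=\sqrt{|x^3|}$. Dilations are $\delta_r(x)=(rx^1,rx^2,r^2x^3)$. $\mathsf d$ is a fixed distance on $\mathbb H$ which is left-invariant and $1$-homogeneous with respect to $\delta_r$; $B(x,r)$ denotes the open $\mathsf d$-ball. Horizontal vector fields: $X_1=\partial_1-x^2\partial_3$, $X_2=\partial_2+x^1\partial_3$. For $\alpha\in(0,1]$, $C^{1,\alpha}_{\mathsf h}(\mathbb H,\mathbb R^k)$ is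 the set of $F:\mathbb H\to\mathbb R^k$ such that $X_1F,X_2F$ exist everywhere and $\nabla_{\mathsf h}F=[X_1F,X_2F]$ is $\alpha$-Hölder w.r.t. $\mathsf d$ on every bounded set. $p$ is nondegenerate for $F:\mathbb H\to\mathbb R^2$ if $\nabla_{\mathsf h}F(p)$ is invertible. $\mathrm R(x,y):=F(y)-F(x)-\nabla_{\mathsf h}F(x)(x^{-1}y)^{\mathsf h}$. LSDE: a continuous $\gamma:I\to\mathbb H$ ($I$ an interval) is a solution if for all $s,t\in I$: $(\gamma_s^{-1}\gamma_t)^{\mathsf h}=-\nabla_{\mathsf h}F(p)^{-1}(\mathrm R(p,\gamma_t)-\mathrm R(p,\gamma_s))$ and $(\gamma_s^{-1}\gamma_t)^{\mathsf v}=t-s+\mathbb E_{st}$ with $\|\mathbb E\|:=\sup_{s\ne t}|\mathbb E_{st}|/|t-s|^{1+\alpha}<\infty$. For $f:I\to\mathbb R^k$, $\|f\|_\beta:=\sup_{s\ne t}|f_t-f_s|/|t-s|^\beta$. $\kappa=\kappa(\alpha)>0$ is the sewing-lemma constant: for any interval $I$ and continuous $A:I^2\to\mathbb R^k$ with $|A_{st}-A_{su}-A_{ut}|\le M|t-s|^{1+\alpha}$ for $s\le u\le t$, there is a continuous $f:I\to\mathbb R^k$ with $|f_t-f_s-A_{st}|\le\kappa M|t-s|^{1+\alpha}$. *)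

theory Defs
  imports "HOL-Analysis.Analysis"
begin

type_synonym heis = "real \<times> real \<times> real"

definition hmul :: "heis \<Rightarrow> heis \<Rightarrow> heis" where
  "hmul x y = (case x of (x1, x2, x3) \<Rightarrow> case y of (y1, y2, y3) \<Rightarrow>
      (x1 + y1, x2 + y2, x3 + y3 + x1 * y2 - x2 * y1))"

definition hinv :: "heis \<Rightarrow> heis" where
  "hinv x = - x"

definition dil :: "real \<Rightarrow> heis \<Rightarrow> heis" where
  "dil r x = (case x of (x1, x2, x3) \<Rightarrow> (r * x1, r * x2, r^2 * x3))"

definition horiz :: "heis \<Rightarrow> real^2" where
  "horiz x = vector [fst x, fst (snd x)]"

definition vert :: "heis \<Rightarrow> real" where
  "vert x = snd (snd x)"

definition heis_distance :: "(heis \<Rightarrow> heis \<Rightarrow> real) \<Rightarrow> bool" where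
  "heis_distance d \<longleftrightarrow>
     (\<forall>x y. d x y = 0 \<longleftrightarrow> x = y) \<and>
     (\<forall>x y. d x y = d y x) \<and>
     (\<forall>x y z. d x z \<le> d x y + d y z) \<and>
     (\<forall>z x y. d (hmul z x) (hmul z y) = d x y) \<and>
     (\<forall>r x y. r > 0 \<longrightarrow> d (dil r x) (dil r y) = r * d x y)"

definition X1_exists :: "(heis \<Rightarrow> real^2) \<Rightarrow> heis \<Rightarrow> bool" where
  "X1_exists F x \<longleftrightarrow> (\<lambda>t. F (hmul x (t, 0, 0))) differentiable (at 0)"

definition X2_exists :: "(heis \<Rightarrow> real^2) \<Rightarrow> heis \<Rightarrow> bool" where
  "X2_exists F x \<longleftrightarrow> (\<lambda>t. F (hmul x (0, t, 0))) differentiable (at 0)"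

definition X1 :: "(heis \<Rightarrow> real^2) \<Rightarrow> heis \<Rightarrow> real^2" where
  "X1 F x = vector_derivative (\<lambda>t. F (hmul x (t, 0, 0))) (at 0)"

definition X2 :: "(heis \<Rightarrow> real^2) \<Rightarrow> heis \<Rightarrow> real^2" where
  "X2 F x = vector_derivative (\<lambda>t. F (hmul x (0, t, 0))) (at 0)"

definition hgrad :: "(heis \<Rightarrow> real^2) \<Rightarrow> heis \<Rightarrow> real^2^2" where
  "hgrad F x = (\<chi> i j. if j = 1 then X1 F x $ i else X2 F x $ i)"

definition d_bounded :: "(heis \<Rightarrow> heis \<Rightarrow> real) \<Rightarrow> heis set \<Rightarrow> bool" where
  "d_bounded d S \<longleftrightarrow> (\<exists>R. \<forall>x\<in>S. d 0 x \<le> R)"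

definition C1alpha_h :: "(heis \<Rightarrow> heis \<Rightarrow> real) \<Rightarrow> real \<Rightarrow> (heis \<Rightarrow> real^2) \<Rightarrow> bool" where
  "C1alpha_h d \<alpha> F \<longleftrightarrow>
     (\<forall>x. X1_exists F x \<and> X2_exists F x) \<and>
     (\<forall>S. d_bounded d S \<longrightarrow>
        (\<exists>C. \<forall>x\<in>S. \<forall>y\<in>S. norm (hgrad F x - hgrad F y) \<le> C * d x y powr \<alpha>))"

definition nondegenerate :: "(heis \<Rightarrow> real^2) \<Rightarrow> heis \<Rightarrow> bool" where
  "nondegenerate F p \<longleftrightarrow> invertible (hgrad F p)"

definition Rem :: "(heis \<Rightarrow> real^2) \<Rightarrow> heis \<Rightarrow> heis \<Rightarrow> real^2" where
  "Rem F x y = F y - F x - hgrad F x *v horiz (hmul (hinv x) y)"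

definition Erem :: "(real \<Rightarrow> heis) \<Rightarrow> real \<Rightarrow> real \<Rightarrow> real" where
  "Erem \<gamma> s t = vert (hmul (hinv (\<gamma> s)) (\<gamma> t)) - (t - s)"

definition holder_norm :: "real \<Rightarrow> real set \<Rightarrow> (real \<Rightarrow> 'a::real_normed_vector) \<Rightarrow> real" where
  "holder_norm \<beta> I f = Sup {norm (f t - f s) / \<bar>t - s\<bar> powr \<beta> | s t. s \<in> I \<and> t \<in> I \<and> s \<noteq> t}"

definition holder_norm2 :: "real \<Rightarrow> real set \<Rightarrow> (real \<Rightarrow> real \<Rightarrow> real) \<Rightarrow> real" where
  "holder_norm2 \<beta> I E = Sup {\<bar>E s t\<bar> / \<bar>t - s\<bar> powr \<beta> | s t. s \<in> I \<and> t \<in> I \<and> s \<noteq> t}"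

definition LSDE_solution ::
  "real \<Rightarrow> (heis \<Rightarrow> real^2) \<Rightarrow> heis \<Rightarrow> real set \<Rightarrow> (real \<Rightarrow> heis) \<Rightarrow> bool" where
  "LSDE_solution \<alpha> F p I \<gamma> \<longleftrightarrow>
     continuous_on I \<gamma> \<and>
     (\<forall>s\<in>I. \<forall>t\<in>I. horiz (hmul (hinv (\<gamma> s)) (\<gamma> t)) =
          - (matrix_inv (hgrad F p) *v (Rem F p (\<gamma> t) - Rem F p (\<gamma> s)))) \<and>
     (\<exists>C. \<forall>s\<in>I. \<forall>t\<in>I. s \<noteq> t \<longrightarrow> \<bar>Erem \<gamma> s t\<bar> \<le> C * \<bar>t - s\<bar> powr (1 + \<alpha>))"

definition sewing_const :: "'a::real_normed_vector itself \<Rightarrow> real \<Rightarrow> real \<Rightarrow> bool" where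
  "sewing_const _ \<alpha> \<kappa> \<longleftrightarrow>
     (\<forall>(I::real set) (A::real \<Rightarrow> real \<Rightarrow> 'a) M.
        is_interval I \<longrightarrow> continuous_on (I \<times> I) (\<lambda>(s, t). A s t) \<longrightarrow>
        (\<forall>s\<in>I. \<forall>u\<in>I. \<forall>t\<in>I. s \<le> u \<longrightarrow> u \<le> t \<longrightarrow>
            norm (A s t - A s u - A u t) \<le> M * \<bar>t - s\<bar> powr (1 + \<alpha>)) \<longrightarrow>
        (\<exists>f::real \<Rightarrow> 'a. continuous_on I f \<and>
           (\<forall>s\<in>I. \<forall>t\<in>I. s \<le> t \<longrightarrow>
              norm (f t - f s - A s t) \<le> \<kappa> * M * \<bar>t - s\<bar> powr (1 + \<alpha>))))"

end

theory Submission
  imports Defs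
begin

text \<open>
  Since \<open>R(p,y) - R(p,x) = F(y) - F(x) - \<nabla>F(p)(x\<inverse>y)\<^sup>h\<close>, the horizontal part of the LSDE says exactly that
  \<open>F\<close> is constant along \<open>\<gamma>\<close>. A horizontal Taylor estimate shows that two points \<open>x, y\<close> near \<open>p\<close> on a
  common level set satisfy \<open>|(x\<inverse>y)\<^sup>h| \<le> 2C |(x\<inverse>y)\<^sup>v|\<^bsup>(1+\<alpha>)/2\<^esup>\<close>, and Brouwer's theorem yields, from a
  point \<open>x\<close> of the level set, another point \<open>y\<close> of it with \<open>(x\<inverse>y)\<^sup>v = h\<close>. Iterating gives
  discrete curves on which a discrete sewing argument (halving the index interval) bounds the vertical error by
  \<open>K|t-s|\<^bsup>1+\<alpha>\<^esup>\<close>, uniformly in the step size. The curves within these bounds form nested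
  closed subsets of a compact product space, so they have a common point, the desired curve;
  uniqueness in the sewing lemma then upgrades \<open>K\<close> to the sharp bound.
\<close>

section \<open>Increments in the Heisenberg group\<close>

definition wedge :: "real^2 \<Rightarrow> real^2 \<Rightarrow> real" where
  "wedge a b = a $ 1 * b $ 2 - a $ 2 * b $ 1"

definition vinc :: "heis \<Rightarrow> heis \<Rightarrow> real" where
  "vinc x y = vert (hmul (hinv x) y)"

text \<open>A coordinate box in place of a ball of \<open>d\<close>: compactness is immediate, and
  the level set construction then refers to no distance.\<close>

definition hbox :: "real \<Rightarrow> heis set" where
  "hbox r = {x. norm (horiz x) \<le> r \<and> \<bar>vert x\<bar> \<le> r}"

lemma norm_real2_squared: "(norm (a :: real^2))\<^sup>2 = (a $ 1)\<^sup>2 + (a $ 2)\<^sup>2"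
  by (simp add: norm_vec_def L2_set_def sum_2)

lemma abs_wedge_le: "\<bar>wedge a b\<bar> \<le> norm a * norm b"
proof (rule power2_le_imp_le[OF _ mult_nonneg_nonneg])
  \<comment> \<open>Lagrange's identity; the discarded square is that of the scalar product.\<close>
  have "(norm a * norm b)\<^sup>2 = (wedge a b)\<^sup>2 + (a $ 1 * b $ 1 + a $ 2 * b $ 2)\<^sup>2"
    unfolding power_mult_distrib norm_real2_squared wedge_def by algebra
  then show "\<bar>wedge a b\<bar>\<^sup>2 \<le> (norm a * norm b)\<^sup>2"
    by simp
qed auto

lemma wedge_self [simp]: "wedge a a = 0"
  by (simp add: wedge_def)

lemma horiz_nth [simp]: "horiz x $ 1 = fst x" "horiz x $ 2 = fst (snd x)"
  by (simp_all add: horiz_def)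

lemma horiz_zero [simp]: "horiz 0 = 0"
  by (simp add: vec_eq_iff forall_2)

lemma vert_zero [simp]: "vert 0 = 0"
  by (simp add: vert_def)

lemma horiz_hmul [simp]: "horiz (hmul x y) = horiz x + horiz y"
  by (simp add: vec_eq_iff forall_2 hmul_def split: prod.split)

lemma horiz_hinv [simp]: "horiz (hinv x) = - horiz x"
  by (simp add: vec_eq_iff forall_2 hinv_def)

lemma vert_hmul: "vert (hmul x y) = vert x + vert y + wedge (horiz x) (horiz y)"
  by (simp add: wedge_def hmul_def vert_def split: prod.split)

lemma vert_hinv [simp]: "vert (hinv x) = - vert x"
  by (simp add: vert_def hinv_def)

lemma heis_eq_iff: "x = y \<longleftrightarrow> horiz x = horiz y \<and> vert x = vert y"
  by (auto simp: vec_eq_iff forall_2 vert_def prod_eq_iff)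

lemma hmul_assoc: "hmul (hmul x y) z = hmul x (hmul y z)"
  by (simp add: heis_eq_iff vert_hmul) (simp add: wedge_def algebra_simps)

lemma hmul_zero [simp]: "hmul 0 x = x" "hmul x 0 = x"
  by (simp_all add: heis_eq_iff vert_hmul wedge_def)

lemma hmul_hinv [simp]: "hmul (hinv x) x = 0" "hmul x (hinv x) = 0"
  by (simp_all add: heis_eq_iff vert_hmul wedge_def)

lemma hmul_hinv_cancel [simp]: "hmul x (hmul (hinv x) y) = y" "hmul (hinv x) (hmul x y) = y"
  by (simp_all flip: hmul_assoc)

lemma hinv_hmul: "hinv (hmul x y) = hmul (hinv y) (hinv x)"
  by (simp add: heis_eq_iff vert_hmul) (simp add: wedge_def algebra_simps)

lemma vinc_eq: "vinc x y = vert y - vert x - wedge (horiz x) (horiz y)"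
  by (simp add: vinc_def vert_hmul) (simp add: wedge_def)

lemma vinc_self [simp]: "vinc x x = 0"
  by (simp add: vinc_eq)

lemma vinc_commute: "vinc y x = - vinc x y"
  by (simp add: vinc_eq wedge_def)

lemma vinc_hmul [simp]: "vinc (hmul p x) (hmul p y) = vinc x y"
  by (simp add: vinc_def hinv_hmul hmul_assoc)

text \<open>The source of the sewing defect: when horizontal increments have order (1+\<alpha>)/2 in
  time, the wedge term has order 1+\<alpha>, above one.\<close>

lemma vinc_split: "vinc x z = vinc x y + vinc y z + wedge (horiz y - horiz x) (horiz z - horiz y)"
  by (simp add: vinc_eq wedge_def algebra_simps)

lemma vert_eq_vinc: "vert y = vert x + vinc x y + wedge (horiz x) (horiz y - horiz x)"
  by (simp add: vinc_eq wedge_def algebra_simps)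

lemma continuous_on_horiz [continuous_intros]:
  assumes "continuous_on S f"
  shows "continuous_on S (\<lambda>x. horiz (f x))"
proof -
  have "horiz y = (\<chi> i. if i = 1 then fst y else fst (snd y))" for y
    by (simp add: vec_eq_iff forall_2)
  moreover have "continuous_on S (\<lambda>x. if i = 1 then fst (f x) else fst (snd (f x)))" for i :: 2
    using assms by (cases "i = 1") (auto intro!: continuous_intros)
  ultimately show ?thesis
    by (simp add: continuous_on_vec_lambda)
qed

lemma continuous_on_vert [continuous_intros]:
  "continuous_on S f \<Longrightarrow> continuous_on S (\<lambda>x. vert (f x))"
  unfolding vert_def by (intro continuous_intros)

lemma continuous_on_wedge [continuous_intros]:
  "continuous_on S f \<Longrightarrow> continuous_on S g \<Longrightarrow> continuous_on S (\<lambda>x. wedge (f x) (g x))"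
  unfolding wedge_def by (intro continuous_intros)

lemma continuous_on_vinc [continuous_intros]:
  "continuous_on S f \<Longrightarrow> continuous_on S g \<Longrightarrow> continuous_on S (\<lambda>x. vinc (f x) (g x))"
  unfolding vinc_eq by (intro continuous_intros)

lemma continuous_on_heisI:
  assumes "continuous_on S (\<lambda>x. horiz (f x))" "continuous_on S (\<lambda>x. vert (f x))"
  shows "continuous_on S f"
proof -
  have "f = (\<lambda>x. (horiz (f x) $ 1, horiz (f x) $ 2, vert (f x)))"
    by (simp add: fun_eq_iff vert_def)
  moreover have "continuous_on S (\<lambda>x. (horiz (f x) $ 1, horiz (f x) $ 2, vert (f x)))"
    by (intro continuous_on_Pair continuous_on_component assms)
  ultimately show ?thesis
    by (rule ssubst[where P = "continuous_on S"])
qed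

lemma norm_heis_le: "norm x \<le> norm (horiz x) + \<bar>vert x\<bar>"
proof -
  obtain x1 x2 x3 where x: "x = (x1, x2, x3)"
    by (cases x)
  have "norm (horiz x) = norm (x1, x2)"
    by (simp add: x norm_vec_def L2_set_def sum_2 norm_Pair)
  moreover have "norm x \<le> norm (x1, x2) + \<bar>x3\<bar>"
    using sqrt_sum_squares_le_sum[of "norm (x1, x2)" "\<bar>x3\<bar>"]
    by (simp add: x norm_Pair add.assoc)
  ultimately show ?thesis
    by (simp add: x vert_def)
qed

lemma compact_hbox: "compact (hbox r)"
proof -
  have "closed (hbox r)"
    unfolding hbox_def Collect_conj_eq
    by (intro closed_Int closed_Collect_le continuous_intros continuous_on_id)
  moreover have "bounded (hbox r)"
  proof (rule boundedI)
    fix x assume "x \<in> hbox r"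
    then show "norm x \<le> r + r"
      using norm_heis_le[of x] unfolding hbox_def by simp
  qed
  ultimately show ?thesis
    by (simp add: compact_eq_bounded_closed)
qed

lemma hbox_mono: "x \<in> hbox r \<Longrightarrow> r \<le> s \<Longrightarrow> x \<in> hbox s"
  by (auto simp: hbox_def)

section \<open>Curves in a level set\<close>

text \<open>The surplus exponent \<alpha> gives the contraction factor. The ratio 2/3 instead of 1/2
  allows for rounding when an integer interval is halved: length 3 splits into 1 and 2.\<close>

lemma powr_split_le:
  fixes a b \<alpha> :: real
  assumes "0 < \<alpha>" "0 \<le> a" "0 \<le> b" "a \<le> 2/3 * (a + b)" "b \<le> 2/3 * (a + b)"
  shows "a powr (1 + \<alpha>) + b powr (1 + \<alpha>) \<le> (2/3) powr \<alpha> * (a + b) powr (1 + \<alpha>)"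
proof -
  have *: "x powr (1 + \<alpha>) \<le> x * ((2/3) powr \<alpha> * (a + b) powr \<alpha>)"
    if "0 \<le> x" "x \<le> 2/3 * (a + b)" for x
  proof -
    have "x powr (1 + \<alpha>) = x * x powr \<alpha>"
      using that by (simp add: powr_add powr_one)
    also have "\<dots> \<le> x * (2/3 * (a + b)) powr \<alpha>"
      using that assms by (intro mult_left_mono powr_mono2) auto
    also have "(2/3 * (a + b)) powr \<alpha> = (2/3) powr \<alpha> * (a + b) powr \<alpha>"
      using assms by (intro powr_mult)
    finally show ?thesis .
  qed
  have "a powr (1 + \<alpha>) + b powr (1 + \<alpha>) \<le> (a + b) * ((2/3) powr \<alpha> * (a + b) powr \<alpha>)"
    using *[of a] *[of b] assms by (simp add: distrib_right)
  also have "\<dots> = (2/3) powr \<alpha> * (a + b) powr (1 + \<alpha>)"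
    using assms by (simp add: powr_add powr_one)
  finally show ?thesis .
qed

lemma powr_half_square:
  fixes a \<alpha> :: real
  assumes "0 \<le> a" shows "(a powr ((1 + \<alpha>) / 2))\<^sup>2 = a powr (1 + \<alpha>)"
  by (simp add: power2_eq_square flip: powr_add)

text \<open>\<open>G\<close> stands for F translated by p and multiplied by the inverse gradient at
  p. Along horizontal increments it perturbs the identity by a factor 1/2, small enough to be
  absorbed; vertical increments enter with exponent (1+\<alpha>)/2.\<close>

locale level_estimate =
  fixes G :: "heis \<Rightarrow> real^2" and r C \<alpha> :: real
  assumes r_pos: "0 < r" and C_pos: "0 < C" and alpha_pos: "0 < \<alpha>" and alpha_le: "\<alpha> \<le> 1"
    and level_est: "\<And>x y. x \<in> hbox r \<Longrightarrow> y \<in> hbox r \<Longrightarrow>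
      norm (G y - G x - (horiz y - horiz x))
        \<le> norm (horiz y - horiz x) / 2 + C * \<bar>vinc x y\<bar> powr ((1 + \<alpha>) / 2)"
begin

text \<open>On a common level the left side of \<open>level_est\<close> is the horizontal increment
  itself, which absorbs the term with factor 1/2.\<close>

lemma horiz_le_vinc:
  assumes "x \<in> hbox r" "y \<in> hbox r" "G x = G y"
  shows "norm (horiz y - horiz x) \<le> 2 * C * \<bar>vinc x y\<bar> powr ((1 + \<alpha>) / 2)"
  using level_est[OF assms(1,2)] assms(3) by (simp add: norm_minus_commute)

text \<open>The form used in the sewing induction, with \<tau> an elapsed time; 2 to the power
  (1+\<alpha>)/2 is at most 2, which turns 2 C into 4 C.\<close>

lemma horiz_le_time:
  assumes "x \<in> hbox r" "y \<in> hbox r" "G x = G y" "\<bar>vinc x y\<bar> \<le> 2 * \<tau>"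
  shows "norm (horiz y - horiz x) \<le> 4 * C * \<tau> powr ((1 + \<alpha>) / 2)"
proof -
  have "0 \<le> \<tau>"
    using assms(4) by linarith
  have "\<bar>vinc x y\<bar> powr ((1 + \<alpha>) / 2) \<le> (2 * \<tau>) powr ((1 + \<alpha>) / 2)"
    using assms(4) alpha_pos by (intro powr_mono2) auto
  also have "\<dots> = 2 powr ((1 + \<alpha>) / 2) * \<tau> powr ((1 + \<alpha>) / 2)"
    using \<open>0 \<le> \<tau>\<close> by (simp add: powr_mult)
  also have "\<dots> \<le> 2 powr 1 * \<tau> powr ((1 + \<alpha>) / 2)"
    using alpha_le by (intro mult_right_mono powr_mono) auto
  finally have "2 * C * \<bar>vinc x y\<bar> powr ((1 + \<alpha>) / 2) \<le> 2 * C * (2 * \<tau> powr ((1 + \<alpha>) / 2))"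
    using C_pos by (intro mult_left_mono) auto
  then show ?thesis
    using horiz_le_vinc[OF assms(1-3)] by simp
qed

text \<open>Both terms of the bound in \<open>level_est\<close> vanish as y tends to x. Brouwer's
  theorem and the closedness of level sets rest on this.\<close>

lemma continuous_on_G: "continuous_on (hbox r) G"
  unfolding continuous_on_def
proof
  fix x assume x: "x \<in> hbox r"
  let ?B = "\<lambda>y. 3/2 * norm (horiz y - horiz x) + C * \<bar>vinc x y\<bar> powr ((1 + \<alpha>) / 2)"
  have h: "((\<lambda>y. horiz y) \<longlongrightarrow> horiz x) (at x within hbox r)"
    and v: "((\<lambda>y. vinc x y) \<longlongrightarrow> vinc x x) (at x within hbox r)"
    using continuous_on_horiz[OF continuous_on_id, of "hbox r"]
      continuous_on_vinc[OF continuous_on_const continuous_on_id, of "hbox r" x] x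
    by (auto simp: continuous_on_def)
  have "(?B \<longlongrightarrow> 3/2 * norm (horiz x - horiz x) + C * \<bar>vinc x x\<bar> powr ((1 + \<alpha>) / 2)) (at x within hbox r)"
    using alpha_pos by (intro tendsto_intros h v tendsto_powr') auto
  then have "(?B \<longlongrightarrow> 0) (at x within hbox r)"
    by simp
  moreover have "norm (G y - G x) \<le> ?B y" if "y \<in> hbox r" for y
    using level_est[OF x that] norm_triangle_sub[of "G y - G x" "horiz y - horiz x"] by linarith
  then have "\<forall>\<^sub>F y in at x within hbox r. norm (G y - G x) \<le> ?B y"
    by (simp add: eventually_at_filter)
  ultimately have "((\<lambda>y. G y - G x) \<longlongrightarrow> 0) (at x within hbox r)"
    by (rule Lim_null_comparison[rotated])
  then show "(G \<longlongrightarrow> G x) (at x within hbox r)"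
    by (simp add: Lim_null[symmetric])
qed

text \<open>The points at vertical increment h from x are parametrised by their horizontal
  displacement z, and G changes by nearly z along this family. A fixed point of z minus this change
  lies exactly on the level of x.\<close>

lemma exists_step:
  assumes x: "x \<in> hbox (r / 2)"
    and h: "4 * C * \<bar>h\<bar> powr ((1 + \<alpha>) / 2) * (1 + r) + \<bar>h\<bar> \<le> r / 2" and h0: "h \<noteq> 0"
  obtains y where "y \<in> hbox r" "G y = G x" "vinc x y = h"
proof -
  \<comment> \<open>The solution of \<rho>/2 + C |h|^((1+\<alpha>)/2) = \<rho>, so that the ball of
    radius \<rho> is mapped into itself.\<close>
  define \<rho> where "\<rho> = 2 * C * \<bar>h\<bar> powr ((1 + \<alpha>) / 2)"
  have "0 < \<rho>"
    using h0 C_pos unfolding \<rho>_def by simp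
  moreover from this have "0 < \<rho> * (1 + r)" "0 < \<rho> * r"
    using r_pos by simp_all
  moreover have "2 * (\<rho> * (1 + r)) + \<bar>h\<bar> \<le> r / 2"
    using h by (simp add: \<rho>_def)
  ultimately have \<rho>: "0 < \<rho>" "\<rho> * (1 + r) + \<bar>h\<bar> \<le> r / 2" "0 < \<rho> * r"
    by linarith+
  \<comment> \<open>The wedge term in the last coordinate keeps the vertical increment from x equal
    to h for every z.\<close>
  define Y :: "real^2 \<Rightarrow> heis" where
    "Y z = (fst x + z $ 1, fst (snd x) + z $ 2, vert x + h + wedge (horiz x) z)" for z
  have Y: "horiz (Y z) = horiz x + z" "vert (Y z) = vert x + h + wedge (horiz x) z" for z
    by (simp_all add: Y_def vec_eq_iff forall_2 vert_def)
  have vY: "vinc x (Y z) = h" for z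
    unfolding vinc_eq Y by (simp add: wedge_def algebra_simps)
  have xr: "x \<in> hbox r"
    using x r_pos by (auto intro: hbox_mono)
  have Yin: "Y z \<in> hbox r" if "norm z \<le> \<rho>" for z
  proof -
    have "norm (horiz x + z) \<le> r / 2 + \<rho>"
      using norm_triangle_ineq[of "horiz x" z] that x by (simp add: hbox_def)
    moreover have "\<bar>wedge (horiz x) z\<bar> \<le> \<rho> * r"
      using abs_wedge_le[of "horiz x" z] mult_mono[of "norm (horiz x)" r "norm z" \<rho>] that xr r_pos
      by (simp add: hbox_def mult.commute)
    moreover have "\<bar>vert x\<bar> \<le> r / 2"
      using x by (simp add: hbox_def)
    moreover have "\<rho> + \<rho> * r + \<bar>h\<bar> \<le> r / 2"
      using \<rho>(2) by (simp add: distrib_left)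
    ultimately show ?thesis
      using \<rho>(1,3) unfolding hbox_def Y mem_Collect_eq by linarith
  qed
  let ?f = "\<lambda>z :: real^2. z - (G (Y z) - G x)"
  have "continuous_on (cball 0 \<rho>) Y"
    by (rule continuous_on_heisI; unfold Y; intro continuous_intros)
  then have cont: "continuous_on (cball 0 \<rho>) ?f"
    using Yin by (intro continuous_intros continuous_on_compose2[OF continuous_on_G]) auto
  have "?f \<in> cball 0 \<rho> \<rightarrow> cball 0 \<rho>"
  proof
    fix z :: "real^2" assume z: "z \<in> cball 0 \<rho>"
    then have "norm (?f z) \<le> norm z / 2 + C * \<bar>h\<bar> powr ((1 + \<alpha>) / 2)"
      using level_est[OF xr Yin[of z]] norm_minus_commute[of z "G (Y z) - G x"] by (simp add: vY Y)
    then show "?f z \<in> cball 0 \<rho>"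
      using z by (simp add: \<rho>_def)
  qed
  from brouwer_ball[OF \<rho>(1) cont this] obtain z where "z \<in> cball 0 \<rho>" "?f z = z" .
  then show thesis
    using that[of "Y z"] Yin[of z] vY by simp
qed

section \<open>Discrete sewing\<close>

definition K :: real where
  "K = 16 * C\<^sup>2 / (1 - (2/3) powr \<alpha>)"

text \<open>\<open>K\<close> is the fixed point of the error recursion: the errors of two halves
  contract by \<open>(2/3) powr \<alpha>\<close>, and the wedge of two increments, each with
  constant 4 C, adds the square 16 C^2.\<close>

lemma K: "0 < K" "(2/3) powr \<alpha> * K + 16 * C\<^sup>2 = K"
proof -
  have "(2/3) powr \<alpha> < (1::real)"
    using alpha_pos using powr_less_mono2[of \<alpha> "2/3" "1::real"] by simp
  then show "0 < K"
    using C_pos unfolding K_def by simp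
  from \<open>(2/3) powr \<alpha> < (1::real)\<close> have "K * (1 - (2/3) powr \<alpha>) = 16 * C\<^sup>2"
    using alpha_pos unfolding K_def by simp
  then show "(2/3) powr \<alpha> * K + 16 * C\<^sup>2 = K"
    by (simp add: algebra_simps)
qed

text \<open>Strong induction on the number of steps. The two conclusions travel together: the bound
  by twice the elapsed time on each half controls its horizontal increment and so the wedge, while
  smallness of K T^\<alpha> restores that bound on the whole interval.\<close>

lemma discrete_sewing:
  fixes x :: "int \<Rightarrow> heis"
  assumes "\<And>k. i \<le> k \<Longrightarrow> k \<le> j \<Longrightarrow> x k \<in> hbox r" "\<And>k. i \<le> k \<Longrightarrow> k \<le> j \<Longrightarrow> G (x k) = g"
    and "\<And>k. i \<le> k \<Longrightarrow> k < j \<Longrightarrow> vinc (x k) (x (k + 1)) = h"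
    and "0 < h" "i \<le> j" "of_int (j - i) * h \<le> T" "K * T powr \<alpha> \<le> 1"
  shows "\<bar>vinc (x i) (x j) - of_int (j - i) * h\<bar> \<le> K * (of_int (j - i) * h) powr (1 + \<alpha>)
    \<and> \<bar>vinc (x i) (x j)\<bar> \<le> 2 * (of_int (j - i) * h)"
  using assms
proof (induction "nat (j - i)" arbitrary: i j rule: less_induct)
  case less
  note step = less.prems(3) and h = less.prems(4) and T = less.prems(6,7)
  define \<tau> where "\<tau> = of_int (j - i) * h"
  have \<tau>: "0 \<le> \<tau>"
    using h less.prems(5) by (simp add: \<tau>_def)
  have E: "\<bar>vinc (x i) (x j) - \<tau>\<bar> \<le> K * \<tau> powr (1 + \<alpha>)"
  \<comment> \<open>With at most one step the increment equals the elapsed time exactly.\<close>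
  proof (cases "j \<le> i + 1")
    case True
    then have "j = i \<or> j = i + 1"
      using less.prems(5) by linarith
    then have "vinc (x i) (x j) = \<tau>"
      using step[of i] by (auto simp: \<tau>_def)
    then show ?thesis
      using K(1) by simp
  next
    case False
    \<comment> \<open>At least two steps remain, so the rounded midpoint is interior and each piece
      has at most two thirds of the steps.\<close>
    define l where "l = (i + j) div 2"
    have l: "i < l" "l < j" "3 * (l - i) \<le> 2 * (j - i)" "3 * (j - l) \<le> 2 * (j - i)"
      using False unfolding l_def by presburger+
    define a b where "a = of_int (l - i) * h" and "b = of_int (j - l) * h"
    have ab: "a + b = \<tau>" "0 \<le> a" "0 \<le> b"
      using h l by (simp_all add: a_def b_def \<tau>_def algebra_simps)
    have "real_of_int (l - i) \<le> 2/3 * real_of_int (j - i)" "real_of_int (j - l) \<le> 2/3 * real_of_int (j - i)"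
      using l(3,4)[THEN of_int_le_iff[where 'a = real, THEN iffD2]] by simp_all
    from this[THEN mult_right_mono, of h] have ab': "a \<le> 2/3 * (a + b)" "b \<le> 2/3 * (a + b)"
      using h unfolding ab(1) a_def b_def \<tau>_def by simp_all
    have IH1: "\<bar>vinc (x i) (x l) - a\<bar> \<le> K * a powr (1 + \<alpha>) \<and> \<bar>vinc (x i) (x l)\<bar> \<le> 2 * a"
      unfolding a_def using l less.prems ab
      by (intro less.hyps) (auto simp: \<tau>_def a_def)
    have IH2: "\<bar>vinc (x l) (x j) - b\<bar> \<le> K * b powr (1 + \<alpha>) \<and> \<bar>vinc (x l) (x j)\<bar> \<le> 2 * b"
      unfolding b_def using l less.prems ab
      by (intro less.hyps) (auto simp: \<tau>_def b_def)
    have "norm (horiz (x l) - horiz (x i)) \<le> 4 * C * a powr ((1 + \<alpha>) / 2)"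
      using IH1 l less.prems(1,2) by (intro horiz_le_time) auto
    moreover have "norm (horiz (x j) - horiz (x l)) \<le> 4 * C * b powr ((1 + \<alpha>) / 2)"
      using IH2 l less.prems(1,2) by (intro horiz_le_time) auto
    moreover have "4 * C * a powr ((1 + \<alpha>) / 2) \<le> 4 * C * \<tau> powr ((1 + \<alpha>) / 2)"
      "4 * C * b powr ((1 + \<alpha>) / 2) \<le> 4 * C * \<tau> powr ((1 + \<alpha>) / 2)"
      using ab alpha_pos C_pos by (intro mult_left_mono powr_mono2; simp)+
    ultimately have "norm (horiz (x l) - horiz (x i)) \<le> 4 * C * \<tau> powr ((1 + \<alpha>) / 2)"
      "norm (horiz (x j) - horiz (x l)) \<le> 4 * C * \<tau> powr ((1 + \<alpha>) / 2)"
      by linarith+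
    from this(1) this(2) order.trans[OF norm_ge_zero this(1)]
    have "norm (horiz (x l) - horiz (x i)) * norm (horiz (x j) - horiz (x l))
       \<le> (4 * C * \<tau> powr ((1 + \<alpha>) / 2)) * (4 * C * \<tau> powr ((1 + \<alpha>) / 2))"
      by (rule mult_mono) simp
    also have "\<dots> = 16 * C\<^sup>2 * \<tau> powr (1 + \<alpha>)"
      unfolding powr_half_square[OF \<tau>, symmetric] by (simp add: power2_eq_square)
    finally have W: "\<bar>wedge (horiz (x l) - horiz (x i)) (horiz (x j) - horiz (x l))\<bar> \<le> 16 * C\<^sup>2 * \<tau> powr (1 + \<alpha>)"
      using abs_wedge_le order.trans by blast
    have "K * (a powr (1 + \<alpha>) + b powr (1 + \<alpha>)) \<le> K * ((2/3) powr \<alpha> * \<tau> powr (1 + \<alpha>))"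
      using powr_split_le[OF alpha_pos ab(2,3) ab'] K(1) ab(1) by (intro mult_left_mono) auto
    then have "K * a powr (1 + \<alpha>) + K * b powr (1 + \<alpha>) + 16 * C\<^sup>2 * \<tau> powr (1 + \<alpha>)
        \<le> ((2/3) powr \<alpha> * K + 16 * C\<^sup>2) * \<tau> powr (1 + \<alpha>)"
      by (simp add: algebra_simps)
    also have "\<dots> = K * \<tau> powr (1 + \<alpha>)"
      unfolding K(2) ..
    finally show ?thesis
      using IH1 IH2 W vinc_split[of "x i" "x j" "x l"] ab(1) by linarith
  qed
  \<comment> \<open>The error is at most \<tau>, hence the increment at most \<tau> +
    \<tau>.\<close>
  have "K * \<tau> powr (1 + \<alpha>) = K * \<tau> powr \<alpha> * \<tau>"
    using \<tau> by (simp add: powr_add powr_one)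
  also have "\<dots> \<le> (K * T powr \<alpha>) * \<tau>"
    using \<tau> T K(1) alpha_pos unfolding \<tau>_def by (intro mult_right_mono mult_left_mono powr_mono2) auto
  also have "\<dots> \<le> 1 * \<tau>"
    using T \<tau> by (intro mult_right_mono) auto
  finally show ?case
    using E \<tau> unfolding \<tau>_def by linarith
qed

end

text \<open>The time 2 \<delta> in \<open>delta_K\<close> is the full length of the interval; the
  bound 1/2, sharper than the 1 of discrete sewing, later gives injectivity.
  \<open>delta_box\<close> confines chains started in the box of size r/4 to that of size r/2 and
  leaves room for one more step.\<close>

locale level_time = level_estimate +
  fixes \<delta> :: real
  assumes delta_pos: "0 < \<delta>" and delta_K: "K * (2 * \<delta>) powr \<alpha> \<le> 1/2"
    and delta_box: "4 * C * \<delta> powr ((1 + \<alpha>) / 2) * (1 + r) + 2 * \<delta> \<le> r / 4"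

lemma (in level_estimate) exists_level_time: "\<exists>\<delta>. level_time G r C \<alpha> \<delta>"
proof -
  have "((\<lambda>\<delta>. K * (2 * \<delta>) powr \<alpha>) \<longlongrightarrow> K * (2 * 0) powr \<alpha>) (at_right 0)"
    using alpha_pos by (intro tendsto_intros tendsto_powr'[OF _ tendsto_const])
      (auto simp: eventually_at_filter)
  then have "\<forall>\<^sub>F \<delta> in at_right 0. K * (2 * \<delta>) powr \<alpha> < 1/2"
    by (rule order_tendstoD) simp
  moreover have "((\<lambda>\<delta>. 4 * C * \<delta> powr ((1 + \<alpha>) / 2) * (1 + r) + 2 * \<delta>)
      \<longlongrightarrow> 4 * C * 0 powr ((1 + \<alpha>) / 2) * (1 + r) + 2 * 0) (at_right 0)"
    using alpha_pos by (intro tendsto_intros tendsto_powr'[OF _ tendsto_const])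
      (auto simp: eventually_at_filter)
  then have "\<forall>\<^sub>F \<delta> in at_right 0. 4 * C * \<delta> powr ((1 + \<alpha>) / 2) * (1 + r) + 2 * \<delta> < r / 4"
    by (rule order_tendstoD) (use r_pos in simp)
  moreover have "\<forall>\<^sub>F \<delta> in at_right 0. (0::real) < \<delta>"
    by (simp add: eventually_at_filter)
  ultimately have "\<forall>\<^sub>F \<delta> in at_right 0. level_time G r C \<alpha> \<delta>"
    by eventually_elim (unfold_locales; simp)
  then show ?thesis
    using eventually_happens trivial_limit_at_right_real by blast
qed

section \<open>Approximating chains and their limit\<close>

context level_time
begin

text \<open>The a priori confinement behind repeated stepping: \<open>horiz_le_time\<close> bounds
  the horizontal displacement from q, and the vertical coordinate moves by the increment plus a
  wedge with that displacement.\<close>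

lemma in_half_box:
  assumes "q \<in> hbox (r / 4)" "x \<in> hbox r" "G x = G q" "\<bar>vinc q x\<bar> \<le> 2 * \<delta>"
  shows "x \<in> hbox (r / 2)"
proof -
  have q: "q \<in> hbox r"
    using assms(1) r_pos by (auto intro: hbox_mono)
  let ?d = "4 * C * \<delta> powr ((1 + \<alpha>) / 2)"
  have d: "norm (horiz x - horiz q) \<le> ?d"
    using assms q by (intro horiz_le_time) auto
  then have "0 \<le> ?d"
    using norm_ge_zero order.trans by blast
  have "norm (horiz q) * norm (horiz x - horiz q) \<le> r * ?d"
    using d q r_pos by (intro mult_mono) (auto simp: hbox_def)
  then have "\<bar>wedge (horiz q) (horiz x - horiz q)\<bar> \<le> ?d * r"
    using abs_wedge_le[of "horiz q" "horiz x - horiz q"] by (simp add: mult.commute)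
  moreover have "norm (horiz x) \<le> norm (horiz q) + ?d"
    using d norm_triangle_sub[of "horiz x" "horiz q"] by linarith
  moreover have "?d + ?d * r + 2 * \<delta> \<le> r / 4"
    using delta_box by (simp only: distrib_left mult_1_right)
  moreover have "0 \<le> ?d * r"
    using mult_nonneg_nonneg[OF \<open>0 \<le> ?d\<close>, of r] r_pos by simp
  moreover have "norm (horiz q) \<le> r / 4" "\<bar>vert q\<bar> \<le> r / 4"
    using assms(1) by (auto simp: hbox_def)
  ultimately show ?thesis
    using \<open>0 \<le> ?d\<close> assms(4) delta_pos vert_eq_vinc[of x q] unfolding hbox_def mem_Collect_eq
    by linarith
qed

lemma delta_small: "\<tau> \<le> 2 * \<delta> \<Longrightarrow> 0 \<le> \<tau> \<Longrightarrow> K * \<tau> powr \<alpha> \<le> 1/2"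
  using delta_K K(1) alpha_pos mult_left_mono[OF powr_mono2[of \<alpha> \<tau> "2 * \<delta>"], of K] by linarith

text \<open>The chain grows by one point at each end. Discrete sewing on the right and left halves
  bounds the vertical increments between q and the ends, so \<open>in_half_box\<close> makes
  \<open>exists_step\<close> applicable again.\<close>

lemma exists_chain:
  assumes q: "q \<in> hbox (r / 4)" and h: "0 < h"
  shows "of_nat n * h \<le> \<delta> \<Longrightarrow> \<exists>x. x 0 = q \<and> (\<forall>k\<in>{- int n..int n}. x k \<in> hbox r \<and> G (x k) = G q)
    \<and> (\<forall>k\<in>{- int n..<int n}. vinc (x k) (x (k + 1)) = h)"
proof (induction n)
  case 0
  have "q \<in> hbox r"
    using q r_pos by (auto intro: hbox_mono)
  then show ?case
    by (intro exI[of _ "\<lambda>_. q"]) simp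
next
  case (Suc n)
  have nh: "real n * h \<le> \<delta>" and h\<delta>: "h \<le> \<delta>"
    using Suc.prems h mult_nonneg_nonneg[of "real n" h] unfolding of_nat_Suc distrib_right by linarith+
  obtain x where *: "x 0 = q \<and> (\<forall>k\<in>{- int n..int n}. x k \<in> hbox r \<and> G (x k) = G q)
      \<and> (\<forall>k\<in>{- int n..<int n}. vinc (x k) (x (k + 1)) = h)"
    using Suc.IH[OF nh] ..
  have x0: "x 0 = q"
    using * by simp
  have x: "x k \<in> hbox r \<and> G (x k) = G q" if "- int n \<le> k" "k \<le> int n" for k
    using * that by simp
  have step: "vinc (x k) (x (k + 1)) = h" if "- int n \<le> k" "k < int n" for k
    using * that by simp
  have K1: "K * \<delta> powr \<alpha> \<le> 1"
    using delta_small[of \<delta>] delta_pos by simp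
  have "\<bar>vinc (x 0) (x (int n))\<bar> \<le> 2 * (of_int (int n - 0) * h)"
    by (rule conjunct2[OF discrete_sewing[OF _ _ _ h _ _ K1]]) (use x step nh in auto)
  then have right: "x (int n) \<in> hbox (r / 2)"
    using x nh x0 by (intro in_half_box[OF q]) auto
  have "\<bar>vinc (x (- int n)) (x 0)\<bar> \<le> 2 * (of_int (0 - - int n) * h)"
    by (rule conjunct2[OF discrete_sewing[OF _ _ _ h _ _ K1]]) (use x step nh in auto)
  then have left: "x (- int n) \<in> hbox (r / 2)"
    using x nh x0 by (intro in_half_box[OF q]) (auto simp: vinc_commute[of "x (- int n)"])
  have "h powr ((1 + \<alpha>) / 2) \<le> \<delta> powr ((1 + \<alpha>) / 2)"
    using h h\<delta> alpha_pos by (intro powr_mono2) auto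
  then have "4 * C * h powr ((1 + \<alpha>) / 2) * (1 + r) \<le> 4 * C * \<delta> powr ((1 + \<alpha>) / 2) * (1 + r)"
    using C_pos r_pos by (intro mult_right_mono mult_left_mono) auto
  then have small: "4 * C * \<bar>h\<bar> powr ((1 + \<alpha>) / 2) * (1 + r) + \<bar>h\<bar> \<le> r / 2"
    using delta_box delta_pos h\<delta> h r_pos by linarith
  obtain y where y: "y \<in> hbox r" "G y = G q" "vinc (x (int n)) y = h"
    using exists_step[OF right small] h x[of "int n"] by auto
  \<comment> \<open>A step by -h from the left end becomes +h when read in the order of increasing
    indices.\<close>
  obtain z where "z \<in> hbox r" "G z = G (x (- int n))" "vinc (x (- int n)) z = - h"
    by (rule exists_step[OF left, of "- h"]) (use small h in auto)
  then have z: "z \<in> hbox r" "G z = G q" "vinc z (x (- int n)) = h"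
    using x[of "- int n"] by (simp_all add: vinc_commute[of z])
  define x' where "x' = x(int n + 1 := y, - int n - 1 := z)"
  have x': "x' k = (if k = int n + 1 then y else if k = - int n - 1 then z else x k)" for k
    by (simp add: x'_def)
  show ?case
  proof (intro exI[of _ x'] conjI ballI)
    show "x' 0 = q"
      by (simp add: x' x0)
    fix k assume k: "k \<in> {- int (Suc n)..int (Suc n)}"
    show "x' k \<in> hbox r" "G (x' k) = G q"
      using k y z x[of k] unfolding x' by auto
  next
    fix k assume "k \<in> {- int (Suc n)..<int (Suc n)}"
    then consider "k = int n" | "k = - int n - 1" | "- int n \<le> k" "k < int n"
      by force
    then show "vinc (x' k) (x' (k + 1)) = h"
      by cases (use y z step[of k] in \<open>auto simp: x'\<close>)
  qed
qed

text \<open>The chain is read as a step function of time. Rounding time by the floor costs \<eta>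
  twice: inside the power and as an additive term.\<close>

lemma exists_approx_curve:
  assumes q: "q \<in> hbox (r / 4)" and \<eta>: "\<eta> = \<delta> / real (Suc n)"
  shows "\<exists>g. g 0 = q \<and> (\<forall>t. g t \<in> hbox r \<and> G (g t) = G q) \<and>
    (\<forall>s t. - \<delta> \<le> s \<longrightarrow> s \<le> t \<longrightarrow> t \<le> \<delta> \<longrightarrow>
      \<bar>vinc (g s) (g t) - (t - s)\<bar> \<le> K * (t - s + \<eta>) powr (1 + \<alpha>) + \<eta>)"
proof -
  have \<eta>0: "0 < \<eta>" and n\<eta>: "real (Suc n) * \<eta> = \<delta>"
    using delta_pos by (simp_all add: \<eta>)
  obtain x where *: "x 0 = q \<and> (\<forall>k\<in>{- int (Suc n)..int (Suc n)}. x k \<in> hbox r \<and> G (x k) = G q)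
      \<and> (\<forall>k\<in>{- int (Suc n)..<int (Suc n)}. vinc (x k) (x (k + 1)) = \<eta>)"
    using exists_chain[OF q \<eta>0, OF eq_refl[OF n\<eta>]] ..
  have x0: "x 0 = q"
    using * by simp
  have x: "x k \<in> hbox r \<and> G (x k) = G q" if "- int (Suc n) \<le> k" "k \<le> int (Suc n)" for k
    using * that by simp
  have step: "vinc (x k) (x (k + 1)) = \<eta>" if "- int (Suc n) \<le> k" "k < int (Suc n)" for k
    using * that by simp
  define \<phi> where "\<phi> t = \<lfloor>t / \<eta>\<rfloor>" for t
  have \<phi>: "- int (Suc n) \<le> \<phi> t" "\<phi> t \<le> int (Suc n)" if "- \<delta> \<le> t" "t \<le> \<delta>" for t
  proof -
    have "t / \<eta> \<le> real (Suc n)" "- real (Suc n) \<le> t / \<eta>"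
      using that \<eta>0 n\<eta> unfolding pos_divide_le_eq[OF \<eta>0] pos_le_divide_eq[OF \<eta>0] mult_minus_left n\<eta> by simp_all
    then show "- int (Suc n) \<le> \<phi> t" "\<phi> t \<le> int (Suc n)"
      unfolding \<phi>_def by linarith+
  qed
  \<comment> \<open>The value q outside the interval keeps g in the level set at all real times, as
    the product space below requires.\<close>
  define g where "g t = (if - \<delta> \<le> t \<and> t \<le> \<delta> then x (\<phi> t) else q)" for t
  show ?thesis
  proof (intro exI[of _ g] conjI allI impI)
    show "g 0 = q"
      by (simp add: g_def \<phi>_def x0)
    show "g t \<in> hbox r" "G (g t) = G q" for t
      using x[OF \<phi>, of t] x[of 0] x0 by (auto simp: g_def)
    fix s t assume st: "- \<delta> \<le> s" "s \<le> t" "t \<le> \<delta>"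
    have le: "\<phi> s \<le> \<phi> t"
      using st \<eta>0 unfolding \<phi>_def by (intro floor_mono divide_right_mono) auto
    define \<tau> where "\<tau> = of_int (\<phi> t - \<phi> s) * \<eta>"
    have "\<bar>of_int (\<phi> t - \<phi> s) - (t / \<eta> - s / \<eta>)\<bar> \<le> 1"
      unfolding \<phi>_def of_int_diff by linarith
    then have "\<bar>of_int (\<phi> t - \<phi> s) - (t / \<eta> - s / \<eta>)\<bar> * \<eta> \<le> 1 * \<eta>"
      using \<eta>0 by (intro mult_right_mono) auto
    also have "\<bar>of_int (\<phi> t - \<phi> s) - (t / \<eta> - s / \<eta>)\<bar> * \<eta>
        = \<bar>(of_int (\<phi> t - \<phi> s) - (t / \<eta> - s / \<eta>)) * \<eta>\<bar>"
      using \<eta>0 by (simp add: abs_mult)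
    also have "(of_int (\<phi> t - \<phi> s) - (t / \<eta> - s / \<eta>)) * \<eta> = \<tau> - (t - s)"
      using \<eta>0 by (simp add: \<tau>_def left_diff_distrib)
    finally have close: "\<bar>\<tau> - (t - s)\<bar> \<le> \<eta>"
      by simp
    define N where "N = int (Suc n)"
    have N: "- N \<le> \<phi> s" "\<phi> t \<le> N"
      using \<phi>[of s] \<phi>[of t] st unfolding N_def by linarith+
    \<comment> \<open>Here sewing runs across both halves at once, hence the time bound 2
      \<delta>.\<close>
    then have "of_int (\<phi> t - \<phi> s) * \<eta> \<le> of_int (2 * N) * \<eta>"
      using \<eta>0 by (intro mult_right_mono) (simp_all only: of_int_le_iff less_imp_le)
    also have "\<dots> = 2 * \<delta>"
      using n\<eta> by (simp add: N_def algebra_simps)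
    finally have \<tau>2: "of_int (\<phi> t - \<phi> s) * \<eta> \<le> 2 * \<delta>" .
    have "\<bar>vinc (x (\<phi> s)) (x (\<phi> t)) - \<tau>\<bar> \<le> K * \<tau> powr (1 + \<alpha>)"
      unfolding \<tau>_def
    proof (rule conjunct1[OF discrete_sewing[OF _ _ _ \<eta>0 le \<tau>2]])
      show "x k \<in> hbox r" "G (x k) = G q" if "\<phi> s \<le> k" "k \<le> \<phi> t" for k
        using x[of k] order.trans[OF N(1) that(1)] order.trans[OF that(2) N(2)] unfolding N_def by auto
      show "vinc (x k) (x (k + 1)) = \<eta>" if "\<phi> s \<le> k" "k < \<phi> t" for k
        using step[of k] order.trans[OF N(1) that(1)] less_le_trans[OF that(2) N(2)] unfolding N_def by auto
      show "K * (2 * \<delta>) powr \<alpha> \<le> 1"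
        using delta_K by simp
    qed
    moreover have "0 \<le> \<tau>"
      using le \<eta>0 by (simp add: \<tau>_def)
    then have "K * \<tau> powr (1 + \<alpha>) \<le> K * (t - s + \<eta>) powr (1 + \<alpha>)"
      using close K(1) alpha_pos by (intro mult_left_mono powr_mono2) auto
    ultimately show "\<bar>vinc (g s) (g t) - (t - s)\<bar> \<le> K * (t - s + \<eta>) powr (1 + \<alpha>) + \<eta>"
      using close st unfolding g_def by simp
  qed
qed

text \<open>Tychonoff's theorem replaces an equicontinuity argument: the approximants are step
  functions, but each condition in \<open>S n\<close> involves only one or two coordinates of g and
  is therefore closed in the product topology.\<close>

lemma exists_level_curve:
  assumes q: "q \<in> hbox (r / 4)"
  shows "\<exists>g. g 0 = q \<and> (\<forall>t. g t \<in> hbox r \<and> G (g t) = G q) \<and>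
    (\<forall>s\<in>{- \<delta>..\<delta>}. \<forall>t\<in>{- \<delta>..\<delta>}. \<bar>vinc (g s) (g t) - (t - s)\<bar> \<le> K * \<bar>t - s\<bar> powr (1 + \<alpha>))"
proof -
  define W where "W = {x \<in> hbox r. G x = G q}"
  define \<eta> where "\<eta> n = \<delta> / real (Suc n)" for n
  define S where "S n = {g. g 0 = q \<and> (\<forall>s t. - \<delta> \<le> s \<longrightarrow> s \<le> t \<longrightarrow> t \<le> \<delta> \<longrightarrow>
      \<bar>vinc (g s) (g t) - (t - s)\<bar> \<le> K * (t - s + \<eta> n) powr (1 + \<alpha>) + \<eta> n)}" for n
  have "closed W"
    unfolding W_def by (intro continuous_closed_preimage_constant continuous_on_G compact_imp_closed compact_hbox)
  then have "compact W"
    using compact_Int_closed[OF compact_hbox[of r], of W] by (simp add: W_def Int_absorb1 Collect_subset)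
  then have P: "compact (PiE UNIV (\<lambda>_ :: real. W))"
    using compactin_PiE[of "\<lambda>_. euclidean" "UNIV :: real set" "\<lambda>_. W"]
    by (simp add: euclidean_product_topology)
  have coord: "continuous_on UNIV (\<lambda>g :: real \<Rightarrow> heis. g t)" for t
    by simp
  have cl: "closed (S n)" for n
    unfolding S_def
    by (intro closed_Collect_conj closed_Collect_all closed_Collect_imp closed_Collect_le closed_Collect_eq
        continuous_intros coord open_Collect_const)
  have dec: "S n \<subseteq> S m" if "m \<le> n" for m n
  proof -
    have "\<eta> n \<le> \<eta> m" "0 \<le> \<eta> n"
      using that delta_pos unfolding \<eta>_def by (auto intro!: divide_left_mono)
    then have le: "K * (t - s + \<eta> n) powr (1 + \<alpha>) + \<eta> n \<le> K * (t - s + \<eta> m) powr (1 + \<alpha>) + \<eta> m"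
      if "s \<le> t" for s t
      using that K(1) alpha_pos by (intro add_mono mult_left_mono powr_mono2) auto
    show ?thesis
    proof
      fix g assume "g \<in> S n"
      then show "g \<in> S m"
        unfolding S_def by (blast intro: order.trans[OF _ le])
    qed
  qed
  have ne: "PiE UNIV (\<lambda>_. W) \<inter> S n \<noteq> {}" for n
    using exists_approx_curve[OF q \<eta>_def[of n]] unfolding S_def W_def by auto
  have "PiE UNIV (\<lambda>_. W) \<inter> (\<Inter>n\<in>UNIV. S n) \<noteq> {}"
  proof (rule compact_imp_fip_image[OF P cl])
    fix I :: "nat set" assume I: "finite I"
    \<comment> \<open>Nestedness reduces a finite family to its largest index; inserting 0 covers
      the empty family.\<close>
    have "S (Max (insert 0 I)) \<subseteq> (\<Inter>n\<in>I. S n)"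
      using I by (intro INF_greatest dec) auto
    then show "PiE UNIV (\<lambda>_. W) \<inter> (\<Inter>n\<in>I. S n) \<noteq> {}"
      using ne[of "Max (insert 0 I)"] by blast
  qed
  then obtain g where g: "\<And>t. g t \<in> W" "\<And>n. g \<in> S n"
    by (auto simp: PiE_iff)
  \<comment> \<open>The common point satisfies the bound for every n, and the rounding terms vanish
    in the limit.\<close>
  have E: "\<bar>vinc (g s) (g t) - (t - s)\<bar> \<le> K * \<bar>t - s\<bar> powr (1 + \<alpha>)" if "- \<delta> \<le> s" "s \<le> t" "t \<le> \<delta>" for s t
  proof -
    have lim: "\<eta> \<longlonglongrightarrow> 0"
      unfolding \<eta>_def using LIMSEQ_Suc[OF lim_const_over_n[of \<delta>]] by simp
    have "0 \<le> t - s + \<eta> n" for n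
      using that delta_pos by (simp add: \<eta>_def)
    then have "(\<lambda>n. K * (t - s + \<eta> n) powr (1 + \<alpha>) + \<eta> n) \<longlonglongrightarrow> K * (t - s + 0) powr (1 + \<alpha>) + 0"
      using alpha_pos by (intro tendsto_intros tendsto_powr'[OF _ tendsto_const] lim) auto
    moreover have "\<bar>vinc (g s) (g t) - (t - s)\<bar> \<le> K * (t - s + \<eta> n) powr (1 + \<alpha>) + \<eta> n" for n
      using g(2)[of n] that unfolding S_def by blast
    ultimately show ?thesis
      using that by (auto dest!: LIMSEQ_le_const)
  qed
  show ?thesis
  proof (intro exI[of _ g] conjI allI ballI)
    show "g 0 = q" "g t \<in> hbox r" "G (g t) = G q" for t
      using g unfolding S_def W_def by auto
    fix s t assume "s \<in> {- \<delta>..\<delta>}" "t \<in> {- \<delta>..\<delta>}"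
    then show "\<bar>vinc (g s) (g t) - (t - s)\<bar> \<le> K * \<bar>t - s\<bar> powr (1 + \<alpha>)"
      using E[of s t] E[of t s] vinc_commute[of "g s" "g t"] by (cases "s \<le> t") (auto simp: abs_minus_commute)
  qed
qed

end

section \<open>Homogeneous distances\<close>

text \<open>Cauchy-Schwarz in each row; the norm of A is the Euclidean norm of its entries, the one
  in the Hoelder hypothesis.\<close>

lemma norm_matrix_vector_mult_le: "norm (A *v x) \<le> norm A * norm (x :: real^'n)" for A :: "real^'n^'m"
proof -
  have "norm (A *v x) \<le> L2_set (\<lambda>i. norm (A $ i) * norm x) UNIV"
    unfolding norm_vec_def[of "A *v x"]
    by (intro L2_set_mono) (auto simp: matrix_vector_mul_component Cauchy_Schwarz_ineq2)
  also have "\<dots> = norm A * norm x"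
    by (simp add: norm_vec_def[of A] L2_set_left_distrib)
  finally show ?thesis .
qed

text \<open>An explicit gauge, homogeneous under dilations, to which \<open>d\<close> is compared
  from both sides.\<close>

definition hn :: "heis \<Rightarrow> real" where
  "hn x = norm (horiz x) + sqrt \<bar>vert x\<bar>"

lemma hn_nonneg: "0 \<le> hn x"
  by (simp add: hn_def)

lemma hn_eq_0_iff: "hn x = 0 \<longleftrightarrow> x = 0"
proof
  assume "hn x = 0"
  then have "norm (horiz x) = 0" "sqrt \<bar>vert x\<bar> = 0"
    using norm_ge_zero[of "horiz x"] real_sqrt_ge_zero[OF abs_ge_zero, of "vert x"] unfolding hn_def by linarith+
  then show "x = 0"
    by (simp add: heis_eq_iff)
qed (simp add: hn_def)

lemma dil_simps [simp]: "horiz (dil r x) = r *\<^sub>R horiz x" "vert (dil r x) = r\<^sup>2 * vert x"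
  by (simp_all add: vec_eq_iff forall_2 dil_def vert_def split: prod.split)

lemma hn_dil: "0 < r \<Longrightarrow> hn (dil r x) = r * hn x"
  by (simp add: hn_def abs_mult real_sqrt_mult distrib_left)

lemma abs_comp_le_hn: "\<bar>fst x\<bar> \<le> hn x" "\<bar>fst (snd x)\<bar> \<le> hn x"
  using component_le_norm_cart[of "horiz x" 1] component_le_norm_cart[of "horiz x" 2]
    real_sqrt_ge_zero[OF abs_ge_zero, of "vert x"] unfolding hn_def horiz_nth by linarith+

lemma abs_vert_le_hn: "\<bar>vert x\<bar> \<le> (hn x)\<^sup>2"
proof -
  have "(sqrt \<bar>vert x\<bar>)\<^sup>2 \<le> (hn x)\<^sup>2"
    by (intro power_mono) (simp_all add: hn_def)
  then show ?thesis
    by simp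
qed

text \<open>The product of the two axis components of x has height
  \<open>fst x * fst (snd x)\<close>; the difference is what remains to be corrected along the
  centre.\<close>

lemma vert_defect_le_hn: "\<bar>vert x - fst x * fst (snd x)\<bar> \<le> 2 * (hn x)\<^sup>2"
proof -
  have "\<bar>fst x * fst (snd x)\<bar> \<le> (hn x)\<^sup>2"
    using mult_mono[OF abs_comp_le_hn[of x] hn_nonneg] by (simp add: abs_mult power2_eq_square)
  then show ?thesis
    using abs_vert_le_hn[of x] by linarith
qed

text \<open>The Boolean selects the axis, so one argument serves both horizontal fields.\<close>

definition axis_pt :: "bool \<Rightarrow> real \<Rightarrow> heis" where
  "axis_pt i t = (if i then (t, 0, 0) else (0, t, 0))"

lemma vert_axis_pt [simp]: "vert (axis_pt i t) = 0"
  by (simp add: axis_pt_def vert_def)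

lemma norm_horiz_axis_pt [simp]: "norm (horiz (axis_pt i t)) = \<bar>t\<bar>"
  by (simp add: axis_pt_def norm_vec_def L2_set_def sum_2)

lemma hn_axis_pt [simp]: "hn (axis_pt i t) = \<bar>t\<bar>"
  by (simp add: hn_def)

lemma horiz_axis_pt_scaleR: "horiz (axis_pt i t) = t *\<^sub>R horiz (axis_pt i 1)"
  by (simp add: axis_pt_def vec_eq_iff forall_2)

lemma hmul_axis_pt: "hmul (hmul x (axis_pt i s)) (axis_pt i t) = hmul x (axis_pt i (s + t))"
  by (simp add: axis_pt_def hmul_assoc) (simp add: hmul_def)

text \<open>The vertical direction is reached through the commutator of the two horizontal axes.\<close>

lemma axis_decomposition:
  obtains ws where "length ws = 6" "\<forall>w\<in>set ws. \<exists>i t. \<bar>t\<bar> \<le> hn g \<and> w = axis_pt i t"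
    "foldr hmul ws 0 = g"
proof -
  obtain x1 x2 x3 where g: "g = (x1, x2, x3)"
    by (cases g)
  \<comment> \<open>The first two moves reach height x1 x2. A commutator with sides s changes the
    height by 2 s^2 in absolute value, which dictates s.\<close>
  define c where "c = x3 - x1 * x2"
  define s where "s = sqrt (\<bar>c\<bar> / 2)"
  have s2: "2 * (s * s) = \<bar>c\<bar>"
    by (simp add: s_def)
  have s: "\<bar>s\<bar> \<le> hn g"
  proof -
    have "\<bar>c\<bar> / 2 \<le> (hn g)\<^sup>2"
      using vert_defect_le_hn[of g] by (simp add: g c_def vert_def)
    then have "s \<le> sqrt ((hn g)\<^sup>2)"
      unfolding s_def by (intro real_sqrt_le_mono)
    then show ?thesis
      using hn_nonneg[of g] by (simp add: s_def)
  qed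
  have x: "\<bar>x1\<bar> \<le> hn g" "\<bar>x2\<bar> \<le> hn g"
    using abs_comp_le_hn[of g] by (simp_all add: g)
  \<comment> \<open>For negative c the axes in the commutator are exchanged, which reverses its
    sign.\<close>
  define ws where "ws = [axis_pt True x1, axis_pt False x2] @
    map (\<lambda>(i, t). axis_pt (i = (0 \<le> c)) t) [(True, s), (False, s), (True, - s), (False, - s)]"
  show thesis
  proof
    show "length ws = 6"
      by (simp add: ws_def)
    show "\<forall>w\<in>set ws. \<exists>i t. \<bar>t\<bar> \<le> hn g \<and> w = axis_pt i t"
    proof
      fix w assume "w \<in> set ws"
      have "\<exists>i t. \<bar>t\<bar> \<le> hn g \<and> axis_pt j u = axis_pt i t" if "\<bar>u\<bar> \<le> hn g" for j u
        using that by blast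
      then show "\<exists>i t. \<bar>t\<bar> \<le> hn g \<and> w = axis_pt i t"
        using \<open>w \<in> set ws\<close> s x unfolding ws_def by auto
    qed
    show "foldr hmul ws 0 = g"
      using s2 by (cases "0 \<le> c") (simp_all add: ws_def axis_pt_def hmul_def zero_prod_def g c_def)
  qed
qed

section \<open>Comparison of homogeneous distances with the gauge\<close>

locale homogeneous_distance =
  fixes d :: "heis \<Rightarrow> heis \<Rightarrow> real"
  assumes heis_distance: "heis_distance d"
begin

lemma d_eq_0_iff: "d x y = 0 \<longleftrightarrow> x = y"
  and d_commute: "d x y = d y x"
  and d_triangle: "d x z \<le> d x y + d y z"
  and d_hmul [simp]: "d (hmul z x) (hmul z y) = d x y"
  and d_dil: "r > 0 \<Longrightarrow> d (dil r x) (dil r y) = r * d x y"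
  using heis_distance unfolding heis_distance_def by blast+

lemma d_nonneg: "0 \<le> d x y"
  using d_triangle[of x x y] d_eq_0_iff[of x x] d_commute[of y x] by simp

lemma d_eq: "d x y = d 0 (hmul (hinv x) y)"
  using d_hmul[of "hinv x" x y] by simp

lemma d_0_hmul: "d 0 (hmul x y) \<le> d 0 x + d 0 y"
  using d_triangle[of 0 "hmul x y" x] d_hmul[of x 0 y] by simp

lemma d_0_hinv: "d 0 (hinv x) = d 0 x"
  using d_hmul[of x 0 "hinv x"] d_commute[of x 0] by simp

lemma d_0_dil: "0 < r \<Longrightarrow> d 0 (dil r x) = r * d 0 x"
  using d_dil[of r 0 x] by (simp add: dil_def zero_prod_def)

lemma d_0_axis_pt: "d 0 (axis_pt i t) = \<bar>t\<bar> * d 0 (axis_pt i 1)"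
proof -
  have pos: "d 0 (axis_pt i t) = t * d 0 (axis_pt i 1)" if "0 < t" for t
    using d_0_dil[OF that, of "axis_pt i 1"] by (simp add: axis_pt_def dil_def split: if_splits)
  have "hinv (axis_pt i t) = axis_pt i (- t)"
    by (simp add: axis_pt_def hinv_def)
  moreover have "axis_pt i 0 = 0"
    by (simp add: axis_pt_def zero_prod_def)
  ultimately show ?thesis
    using pos[of t] pos[of "- t"] d_0_hinv[of "axis_pt i t"] d_eq_0_iff[of 0 0]
    by (cases t "0 :: real" rule: linorder_cases) auto
qed

lemma d_0_vertical: "d 0 (0, 0, c) = sqrt \<bar>c\<bar> * d 0 (0, 0, 1)"
proof -
  have pos: "d 0 (0, 0, c) = sqrt c * d 0 (0, 0, 1)" if "0 < c" for c
    using d_0_dil[of "sqrt c" "(0, 0, 1)"] that by (simp add: dil_def)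
  have "hinv (0, 0, c) = (0, 0, - c)"
    by (simp add: hinv_def)
  then show ?thesis
    using pos[of c] pos[of "- c"] d_0_hinv[of "(0, 0, c)"] d_eq_0_iff[of 0 0]
    by (cases c "0 :: real" rule: linorder_cases) (auto simp: zero_prod_def)
qed

definition c_up :: real where
  "c_up = d 0 (axis_pt True 1) + d 0 (axis_pt False 1) + 2 * d 0 (0, 0, 1)"

lemma c_up_nonneg: "0 \<le> c_up"
  by (simp add: c_up_def d_nonneg)

text \<open>Factor x into two axis points and a central point; on each factor homogeneity makes the
  distance explicit.\<close>

lemma d_0_le_hn: "d 0 x \<le> c_up * hn x"
proof -
  obtain x1 x2 x3 where x: "x = (x1, x2, x3)"
    by (cases x)
  have x_eq: "x = hmul (hmul (axis_pt True x1) (axis_pt False x2)) (0, 0, x3 - x1 * x2)"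
    by (simp add: x axis_pt_def hmul_def)
  have s: "sqrt \<bar>x3 - x1 * x2\<bar> \<le> 2 * hn x"
    using vert_defect_le_hn[of x] hn_nonneg[of x]
    by (intro real_le_lsqrt) (auto simp: x vert_def power_mult_distrib)
  have "d 0 x \<le> d 0 (axis_pt True x1) + d 0 (axis_pt False x2) + d 0 (0, 0, x3 - x1 * x2)"
    using d_0_hmul[of "hmul (axis_pt True x1) (axis_pt False x2)" "(0, 0, x3 - x1 * x2)"]
      d_0_hmul[of "axis_pt True x1" "axis_pt False x2"] unfolding x_eq[symmetric] by linarith
  also have "\<dots> = \<bar>x1\<bar> * d 0 (axis_pt True 1) + \<bar>x2\<bar> * d 0 (axis_pt False 1)
      + sqrt \<bar>x3 - x1 * x2\<bar> * d 0 (0, 0, 1)"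
    using d_0_axis_pt[of True x1] d_0_axis_pt[of False x2] d_0_vertical[of "x3 - x1 * x2"] by linarith
  also have "\<dots> \<le> hn x * d 0 (axis_pt True 1) + hn x * d 0 (axis_pt False 1) + 2 * hn x * d 0 (0, 0, 1)"
    using s abs_comp_le_hn[of x] by (intro add_mono mult_right_mono d_nonneg) (simp_all add: x)
  also have "\<dots> = c_up * hn x"
    by (simp add: c_up_def algebra_simps)
  finally show ?thesis .
qed

text \<open>Continuity in the coordinates follows from the upper comparison applied to x^-1 y; it is
  what allows minimising over a compact set.\<close>

lemma continuous_on_d_0: "continuous_on UNIV (d 0)"
  unfolding continuous_on_def
proof
  fix x :: heis
  let ?B = "\<lambda>y. c_up * (norm (horiz y - horiz x) + sqrt \<bar>vinc x y\<bar>)"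
  have h: "((\<lambda>y. horiz y) \<longlongrightarrow> horiz x) (at x)" and v: "((\<lambda>y. vinc x y) \<longlongrightarrow> vinc x x) (at x)"
    using continuous_on_horiz[OF continuous_on_id, of UNIV]
      continuous_on_vinc[OF continuous_on_const continuous_on_id, of UNIV x]
    unfolding continuous_on_def by blast+
  have "(?B \<longlongrightarrow> c_up * (norm (horiz x - horiz x) + sqrt \<bar>vinc x x\<bar>)) (at x)"
    by (intro tendsto_intros h v)
  then have B: "(?B \<longlongrightarrow> 0) (at x)"
    by simp
  have "norm (d 0 y - d 0 x) \<le> ?B y" for y
  proof -
    have "\<bar>d 0 y - d 0 x\<bar> \<le> d x y"
      using d_triangle[of 0 y x] d_triangle[of 0 x y] d_commute[of x y] by linarith
    also have "d x y \<le> c_up * hn (hmul (hinv x) y)"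
      unfolding d_eq[of x] by (rule d_0_le_hn)
    finally show ?thesis
      by (simp add: hn_def vinc_def)
  qed
  then have "((\<lambda>y. d 0 y - d 0 x) \<longlongrightarrow> 0) (at x)"
    using B by (intro Lim_null_comparison[OF always_eventually B]) auto
  then show "(d 0 \<longlongrightarrow> d 0 x) (at x within UNIV)"
    by (simp add: Lim_null[symmetric])
qed

text \<open>The distance has a positive minimum on the compact unit sphere of the gauge, and
  dilations carry the bound to all other points.\<close>

lemma exists_hn_le_d_0: "\<exists>c>0. \<forall>x. hn x \<le> c * d 0 x"
proof -
  define S where "S = {x. hn x = 1}"
  have "closed S"
    unfolding S_def hn_def by (intro closed_Collect_eq continuous_intros continuous_on_id)
  moreover have "bounded S"
  proof (rule boundedI)
    fix x assume "x \<in> S"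
    then have "norm (horiz x) \<le> 1" "\<bar>vert x\<bar> \<le> 1"
      using abs_vert_le_hn[of x] real_sqrt_ge_zero[OF abs_ge_zero, of "vert x"]
      unfolding S_def hn_def mem_Collect_eq by (linarith, simp)
    then show "norm x \<le> 2"
      using norm_heis_le[of x] by linarith
  qed
  ultimately have "compact S"
    by (simp add: compact_eq_bounded_closed)
  moreover have "axis_pt True 1 \<in> S"
    by (simp add: S_def)
  ultimately obtain z where z: "z \<in> S" "\<And>x. x \<in> S \<Longrightarrow> d 0 z \<le> d 0 x"
    using continuous_attains_inf[OF _ _ continuous_on_subset[OF continuous_on_d_0 subset_UNIV], of S] by blast
  then have "z \<noteq> 0"
    using hn_eq_0_iff[of z] by (auto simp: S_def)
  then have pos: "0 < d 0 z"
    using d_nonneg[of 0 z] d_eq_0_iff[of 0 z] by simp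
  have "hn x \<le> 1 / d 0 z * d 0 x" for x
  proof (cases "x = 0")
    case True
    then show ?thesis
      using hn_eq_0_iff[of x] d_eq_0_iff[of 0 0] by simp
  next
    case False
    then have h: "0 < hn x"
      using hn_eq_0_iff[of x] hn_nonneg[of x] by simp
    then have "dil (1 / hn x) x \<in> S"
      using hn_dil[of "1 / hn x" x] by (simp add: S_def)
    then have "d 0 z \<le> 1 / hn x * d 0 x"
      using z(2) d_0_dil[of "1 / hn x" x] h by fastforce
    then show ?thesis
      using h pos by (simp add: field_simps)
  qed
  then show ?thesis
    using pos by (intro exI[of _ "1 / d 0 z"]) simp
qed

end

section \<open>The horizontal Taylor estimate\<close>

lemma matrix_inv_mult_left: "invertible A \<Longrightarrow> matrix_inv A ** A = mat 1"
  unfolding invertible_def matrix_inv_def by (rule someI2_ex) auto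

lemma hgrad_mult_axis:
  "hgrad F x *v horiz (axis_pt i t) = t *\<^sub>R (if i then X1 F x else X2 F x)"
  by (simp add: vec_eq_iff matrix_vector_mult_def sum_2 hgrad_def axis_pt_def)

text \<open>The fields are defined by derivatives at parameter 0. Moves along one axis add up, so
  restarting the line at parameter t gives the derivative there.\<close>

lemma axis_has_vector_derivative:
  assumes "\<And>x. X1_exists F x \<and> X2_exists F x"
  shows "((\<lambda>u. F (hmul x (axis_pt i u))) has_vector_derivative hgrad F (hmul x (axis_pt i t)) *v horiz (axis_pt i 1)) (at t)"
proof -
  have "((\<lambda>u. F (hmul y (axis_pt i u))) has_vector_derivative hgrad F y *v horiz (axis_pt i 1)) (at 0)" for y
    using assms[of y] unfolding hgrad_mult_axis X1_exists_def X2_exists_def X1_def X2_def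
    by (auto simp: vector_derivative_works axis_pt_def)
  from this[of "hmul x (axis_pt i t)"]
  have *: "((\<lambda>u. F (hmul x (axis_pt i (t + u)))) has_vector_derivative
      hgrad F (hmul x (axis_pt i t)) *v horiz (axis_pt i 1)) (at (t - t))"
    by (simp add: hmul_axis_pt)
  have "((\<lambda>u. u - t) has_vector_derivative 1) (at t)"
    by (auto intro!: derivative_eq_intros)
  from vector_diff_chain_at[OF this *] show ?thesis
    by (simp add: o_def)
qed

text \<open>The Hoelder constant is fixed on the unit ball around p; conditions of the form
  \<open>d p x + _ \<le> 1\<close> below keep all base points in it.\<close>

locale horizontal_holder = homogeneous_distance +
  fixes F :: "heis \<Rightarrow> real^2" and p :: heis and \<alpha> L :: real
  assumes alpha_pos: "0 < \<alpha>" and L_nonneg: "0 \<le> L"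
    and X_exists: "\<And>x. X1_exists F x \<and> X2_exists F x"
    and hgrad_holder: "\<And>x y. d p x \<le> 1 \<Longrightarrow> d p y \<le> 1 \<Longrightarrow> norm (hgrad F x - hgrad F y) \<le> L * d x y powr \<alpha>"
begin

lemma d_axis_le: "\<bar>t\<bar> \<le> \<rho> \<Longrightarrow> d x (hmul x (axis_pt i t)) \<le> c_up * \<rho>"
  using d_hmul[of x 0 "axis_pt i t"] d_0_le_hn[of "axis_pt i t"] mult_left_mono[OF _ c_up_nonneg, of "\<bar>t\<bar>" \<rho>]
  by simp

lemma hgrad_axis_le:
  assumes "d p x + c_up * \<rho> \<le> 1" "\<bar>t\<bar> \<le> \<rho>"
  shows "norm (hgrad F (hmul x (axis_pt i t)) - hgrad F x) \<le> L * (c_up * \<rho>) powr \<alpha>"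
proof -
  let ?y = "hmul x (axis_pt i t)"
  have dxy: "d x ?y \<le> c_up * \<rho>"
    by (rule d_axis_le[OF assms(2)])
  then have "d p ?y \<le> 1" "d p x \<le> 1"
    using assms(1) d_triangle[of p ?y x] d_nonneg[of x ?y] by linarith+
  then have "norm (hgrad F ?y - hgrad F x) \<le> L * d ?y x powr \<alpha>"
    by (rule hgrad_holder)
  also have "\<dots> \<le> L * (c_up * \<rho>) powr \<alpha>"
    using dxy alpha_pos L_nonneg d_nonneg unfolding d_commute[of ?y x]
    by (intro mult_left_mono powr_mono2) auto
  finally show ?thesis .
qed

lemma axis_step:
  assumes "d p x + c_up * \<rho> \<le> 1" "\<bar>t\<bar> \<le> \<rho>"
  shows "norm (F (hmul x (axis_pt i t)) - F x - hgrad F x *v horiz (axis_pt i t)) \<le> L * (c_up * \<rho>) powr \<alpha> * \<rho>"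
proof -
  define e where "e = horiz (axis_pt i 1)"
  \<comment> \<open>Subtracting the linear part leaves a difference of gradients as derivative, to
    which the mean value inequality applies.\<close>
  define \<phi> where "\<phi> u = F (hmul x (axis_pt i u)) - u *\<^sub>R (hgrad F x *v e)" for u
  have "norm (\<phi> t - \<phi> 0) \<le> L * (c_up * \<rho>) powr \<alpha> * norm (t - 0)"
  proof (rule differentiable_bound[where S = "closed_segment 0 t"])
    fix u assume "u \<in> closed_segment 0 t"
    then have u: "\<bar>u\<bar> \<le> \<rho>"
      using assms(2) by (auto simp: closed_segment_eq_real_ivl split: if_splits)
    let ?D = "hgrad F (hmul x (axis_pt i u)) *v e - hgrad F x *v e"
    have "(\<phi> has_vector_derivative ?D) (at u)"
      unfolding \<phi>_def e_def
      by (auto intro!: derivative_eq_intros axis_has_vector_derivative X_exists)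
    then show "(\<phi> has_derivative (\<lambda>h. h *\<^sub>R ?D)) (at u within closed_segment 0 t)"
      unfolding has_vector_derivative_def by (rule has_derivative_at_withinI)
    have "norm ?D \<le> norm (hgrad F (hmul x (axis_pt i u)) - hgrad F x) * norm e"
      unfolding matrix_vector_mult_diff_rdistrib[symmetric] by (rule norm_matrix_vector_mult_le)
    also have "\<dots> \<le> L * (c_up * \<rho>) powr \<alpha>"
      using hgrad_axis_le[OF assms(1) u, of i] by (simp add: e_def)
    finally show "onorm (\<lambda>h. h *\<^sub>R ?D) \<le> L * (c_up * \<rho>) powr \<alpha>"
      by (intro onorm_le) (metis mult.commute mult_right_mono norm_ge_zero norm_scaleR real_norm_def)
  qed auto
  also have "\<dots> \<le> L * (c_up * \<rho>) powr \<alpha> * \<rho>"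
    using assms(2) L_nonneg by (intro mult_left_mono) auto
  finally have "norm (\<phi> t - \<phi> 0) \<le> L * (c_up * \<rho>) powr \<alpha> * \<rho>" .
  moreover have "axis_pt i 0 = 0"
    by (simp add: axis_pt_def zero_prod_def)
  moreover have "hgrad F x *v horiz (axis_pt i t) = t *\<^sub>R (hgrad F x *v e)"
    unfolding e_def horiz_axis_pt_scaleR[of i t] by (rule matrix_vector_mult_scaleR)
  ultimately show ?thesis
    by (simp add: \<phi>_def algebra_simps)
qed

lemma norm_horiz_foldr_le:
  assumes "\<And>w. w \<in> set ws \<Longrightarrow> \<exists>i t. \<bar>t\<bar> \<le> \<rho> \<and> w = axis_pt i t"
  shows "norm (horiz (foldr hmul ws 0)) \<le> real (length ws) * \<rho>"
  using assms
proof (induction ws)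
  case (Cons w ws)
  then have "norm (horiz (foldr hmul ws 0)) \<le> real (length ws) * \<rho>"
    by simp
  moreover have "norm (horiz w) \<le> \<rho>"
    using Cons.prems[of w] by auto
  ultimately show ?case
    using norm_triangle_ineq[of "horiz w" "horiz (foldr hmul ws 0)"] by (simp add: distrib_right)
qed simp

text \<open>Each move costs one remainder along an axis plus a change of gradient acting on the n
  moves still to come; 1 + n + n^2 is at most (n+1)^2.\<close>

lemma taylor_foldr:
  assumes "\<And>w. w \<in> set ws \<Longrightarrow> \<exists>i t. \<bar>t\<bar> \<le> \<rho> \<and> w = axis_pt i t" "0 \<le> \<rho>"
    and "d p x + real (length ws) * (c_up * \<rho>) \<le> 1"
  shows "norm (F (hmul x (foldr hmul ws 0)) - F x - hgrad F x *v horiz (foldr hmul ws 0))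
    \<le> (real (length ws))\<^sup>2 * (L * (c_up * \<rho>) powr \<alpha> * \<rho>)"
  using assms
proof (induction ws arbitrary: x)
  case (Cons w ws)
  define b where "b = L * (c_up * \<rho>) powr \<alpha> * \<rho>"
  define P where "P = foldr hmul ws 0"
  define n where "n = real (length ws)"
  obtain i t where w: "w = axis_pt i t" and t: "\<bar>t\<bar> \<le> \<rho>"
    using Cons.prems(1)[of w] by auto
  have n: "0 \<le> n * (c_up * \<rho>)" "0 \<le> n" "0 \<le> b"
    using Cons.prems(2) c_up_nonneg L_nonneg by (auto simp: n_def b_def)
  have dn: "d p x + c_up * \<rho> + n * (c_up * \<rho>) \<le> 1"
    using Cons.prems(3) by (simp add: n_def algebra_simps)
  then have dx: "d p x + c_up * \<rho> \<le> 1"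
    using n by linarith
  have "d p (hmul x w) + n * (c_up * \<rho>) \<le> 1"
    using dn d_triangle[of p "hmul x w" x] d_axis_le[OF t, of x i] unfolding w by linarith
  then have IH: "norm (F (hmul (hmul x w) P) - F (hmul x w) - hgrad F (hmul x w) *v horiz P) \<le> n\<^sup>2 * b"
    using Cons.IH[of "hmul x w"] Cons.prems(1,2) by (simp add: n_def P_def b_def)
  have step: "norm (F (hmul x w) - F x - hgrad F x *v horiz w) \<le> b"
    unfolding w b_def by (rule axis_step[OF dx t])
  have "norm ((hgrad F (hmul x w) - hgrad F x) *v horiz P) \<le> norm (hgrad F (hmul x w) - hgrad F x) * norm (horiz P)"
    by (rule norm_matrix_vector_mult_le)
  also have "\<dots> \<le> L * (c_up * \<rho>) powr \<alpha> * (n * \<rho>)"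
    using hgrad_axis_le[OF dx t, of i] norm_horiz_foldr_le[of ws \<rho>] Cons.prems(1) L_nonneg
    unfolding w P_def n_def by (intro mult_mono) auto
  finally have grad: "norm ((hgrad F (hmul x w) - hgrad F x) *v horiz P) \<le> n * b"
    by (simp add: b_def algebra_simps)
  have "F (hmul x (hmul w P)) - F x - hgrad F x *v horiz (hmul w P)
      = (F (hmul x w) - F x - hgrad F x *v horiz w)
      + (F (hmul (hmul x w) P) - F (hmul x w) - hgrad F (hmul x w) *v horiz P)
      + (hgrad F (hmul x w) - hgrad F x) *v horiz P"
    by (simp add: hmul_assoc matrix_vector_mult_diff_rdistrib matrix_vector_right_distrib)
  also have "norm \<dots> \<le> b + n\<^sup>2 * b + n * b"
    using step IH grad by (intro norm_triangle_le add_mono) auto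
  also have "\<dots> \<le> (n + 1)\<^sup>2 * b"
    using n by (simp add: power2_eq_square algebra_simps)
  finally show ?case
    by (simp add: P_def n_def b_def add.commute)
qed simp

text \<open>Six axis moves of size at most the gauge of g reach the target, whence 6 in the
  hypothesis and 36 in the bound.\<close>

lemma taylor:
  assumes "d p x + 6 * (c_up * hn g) \<le> 1"
  shows "norm (F (hmul x g) - F x - hgrad F x *v horiz g) \<le> 36 * (L * (c_up * hn g) powr \<alpha> * hn g)"
proof -
  obtain ws where ws: "length ws = 6" "\<forall>w\<in>set ws. \<exists>i t. \<bar>t\<bar> \<le> hn g \<and> w = axis_pt i t"
    "foldr hmul ws 0 = g"
    by (rule axis_decomposition)
  have "norm (F (hmul x (foldr hmul ws 0)) - F x - hgrad F x *v horiz (foldr hmul ws 0))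
      \<le> (real (length ws))\<^sup>2 * (L * (c_up * hn g) powr \<alpha> * hn g)"
    using ws(1,2) assms by (intro taylor_foldr hn_nonneg) auto
  then show ?thesis
    by (simp add: ws(1,3))
qed

text \<open>Separates the remainder of order 1+\<alpha>: the horizontal part keeps a factor that is
  small with s and can be absorbed, the vertical part keeps exponent (1+\<alpha>)/2. The 4 bounds
  2^(1+\<alpha>).\<close>

lemma hn_powr_le:
  assumes "norm (horiz g) \<le> s" "\<alpha> \<le> 1"
  shows "hn g powr \<alpha> * hn g \<le> 4 * (s powr \<alpha> * norm (horiz g) + \<bar>vert g\<bar> powr ((1 + \<alpha>) / 2))"
proof -
  define a b where "a = norm (horiz g)" and "b = sqrt \<bar>vert g\<bar>"
  have ab: "0 \<le> a" "0 \<le> b" "hn g = a + b"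
    by (simp_all add: a_def b_def hn_def)
  have *: "m powr \<alpha> * m = m powr (1 + \<alpha>)" if "0 \<le> m" for m :: real
    using that by (simp add: powr_add powr_one)
  have b: "b powr (1 + \<alpha>) = \<bar>vert g\<bar> powr ((1 + \<alpha>) / 2)"
    by (simp add: b_def powr_half_sqrt[symmetric] powr_powr)
  have a: "a powr (1 + \<alpha>) \<le> s powr \<alpha> * a"
    unfolding *[OF ab(1), symmetric] using assms ab(1) alpha_pos
    by (intro mult_right_mono powr_mono2) (auto simp: a_def)
  have "(a + b) powr (1 + \<alpha>) \<le> (2 * max a b) powr (1 + \<alpha>)"
    using ab alpha_pos by (intro powr_mono2) auto
  also have "\<dots> = 2 powr (1 + \<alpha>) * max a b powr (1 + \<alpha>)"
    using ab by (simp add: powr_mult)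
  also have "\<dots> \<le> 2 powr 2 * (a powr (1 + \<alpha>) + b powr (1 + \<alpha>))"
    using assms by (intro mult_mono powr_mono) (auto simp: max_def)
  finally have "(a + b) powr (1 + \<alpha>) \<le> 4 * (a powr (1 + \<alpha>) + b powr (1 + \<alpha>))"
    by simp
  then show ?thesis
    using a b *[of "a + b"] ab unfolding a_def[symmetric] by simp
qed

text \<open>The inverse gradient turns the linear part at p into the identity. As r shrinks, Taylor
  error and gradient variation act on the horizontal increment with arbitrarily small
  coefficients.\<close>

lemma exists_level_estimate:
  assumes inv: "invertible (hgrad F p)" and \<alpha>: "\<alpha> \<le> 1"
  shows "\<exists>r C. level_estimate (\<lambda>x. matrix_inv (hgrad F p) *v F (hmul p x)) r C \<alpha>"
proof -
  define A where "A = hgrad F p"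
  define B where "B = matrix_inv A"
  have BA: "B *v (A *v v) = v" for v
    using matrix_inv_mult_left[OF inv] by (simp add: A_def B_def matrix_vector_mul_assoc)
  define M where "M = 36 * (L * c_up powr \<alpha>)"
  have M: "0 \<le> M"
    using L_nonneg by (simp add: M_def)
  \<comment> \<open>\<open>?u\<close> bounds the distance of the base point from p plus six moves,
    as \<open>taylor\<close> demands; \<open>?v\<close> collects the coefficients of the horizontal
    increment, from the remainder and from replacing the gradient by that at p.\<close>
  let ?u = "\<lambda>r. c_up * (r + sqrt r) + 6 * (c_up * (2 * r + sqrt (3 * r)))"
  let ?v = "\<lambda>r. norm B * (4 * M * (2 * r) powr \<alpha> + L * (c_up * (r + sqrt r)) powr \<alpha>)"
  have ev: "\<forall>\<^sub>F r in at_right 0. (0::real) < r"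
    by (simp add: eventually_at_filter)
  have "(?u \<longlongrightarrow> c_up * (0 + sqrt 0) + 6 * (c_up * (2 * 0 + sqrt (3 * 0)))) (at_right 0)"
    by (intro tendsto_intros)
  then have "\<forall>\<^sub>F r in at_right 0. ?u r < 1"
    by (rule order_tendstoD) simp
  moreover have "(?v \<longlongrightarrow> norm B * (4 * M * (2 * 0) powr \<alpha> + L * (c_up * (0 + sqrt 0)) powr \<alpha>)) (at_right 0)"
    using alpha_pos c_up_nonneg
    by (intro tendsto_intros tendsto_powr'[OF _ tendsto_const]; auto intro: eventually_mono[OF ev])
  then have "\<forall>\<^sub>F r in at_right 0. ?v r < 1/2"
    by (rule order_tendstoD) simp
  moreover have "\<forall>\<^sub>F r in at_right 0. (r::real) < 1"
    by (intro order_tendstoD(2)[OF tendsto_ident_at]) simp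
  moreover note ev
  ultimately have "\<forall>\<^sub>F r in at_right 0. ?u r < 1 \<and> ?v r < 1/2 \<and> r < 1 \<and> 0 < r"
    by eventually_elim simp
  then obtain r where r: "?u r < 1" "?v r < 1/2" "r < 1" "0 < r"
    using eventually_happens trivial_limit_at_right_real by blast
  \<comment> \<open>The added 1 keeps C positive even if M vanishes.\<close>
  define C where "C = norm B * (4 * M) + 1"
  have "level_estimate (\<lambda>x. B *v F (hmul p x)) r C \<alpha>"
  proof
    show "0 < r" "0 < C" "0 < \<alpha>" "\<alpha> \<le> 1"
      using r M alpha_pos \<alpha> by (simp_all add: C_def add_nonneg_pos)
    fix x y assume x: "x \<in> hbox r" and y: "y \<in> hbox r"
    define g where "g = hmul (hinv x) y"
    have g: "hmul (hmul p x) g = hmul p y" "horiz g = horiz y - horiz x" "vert g = vinc x y"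
      by (simp_all add: g_def hmul_assoc vinc_def)
    have "\<bar>wedge (horiz x) (horiz y)\<bar> \<le> r * r"
      using order.trans[OF abs_wedge_le mult_mono] x y r(4) unfolding hbox_def by auto
    moreover have "r * r \<le> r"
      using r by (simp add: mult_left_le)
    ultimately have vg: "\<bar>vert g\<bar> \<le> 3 * r"
      using x y unfolding g vinc_eq hbox_def mem_Collect_eq by linarith
    have hg: "norm (horiz g) \<le> 2 * r"
      using norm_triangle_ineq4[of "horiz y" "horiz x"] x y by (simp add: g hbox_def)
    have "hn g \<le> 2 * r + sqrt (3 * r)"
      unfolding hn_def using hg vg by (intro add_mono) auto
    then have dg: "c_up * hn g \<le> c_up * (2 * r + sqrt (3 * r))"
      by (rule mult_left_mono[OF _ c_up_nonneg])
    have "hn x \<le> r + sqrt r"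
      unfolding hn_def using x by (intro add_mono) (auto simp: hbox_def)
    then have dx: "d p (hmul p x) \<le> c_up * (r + sqrt r)"
      using d_hmul[of p 0 x] d_0_le_hn[of x] mult_left_mono[OF _ c_up_nonneg, of "hn x" "r + sqrt r"]
      by simp
    have pos: "0 \<le> c_up * (2 * r + sqrt (3 * r))"
      using r(4) c_up_nonneg by simp
    have "norm (F (hmul p y) - F (hmul p x) - hgrad F (hmul p x) *v horiz g)
        \<le> 36 * (L * (c_up * hn g) powr \<alpha> * hn g)"
      unfolding g(1)[symmetric] using r(1) dx dg by (intro taylor) linarith
    also have "\<dots> = M * (hn g powr \<alpha> * hn g)"
      by (simp add: M_def powr_mult c_up_nonneg hn_nonneg)
    also have "\<dots> \<le> M * (4 * ((2 * r) powr \<alpha> * norm (horiz g) + \<bar>vert g\<bar> powr ((1 + \<alpha>) / 2)))"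
      by (intro mult_left_mono hn_powr_le hg \<alpha> M)
    finally have T: "norm (F (hmul p y) - F (hmul p x) - hgrad F (hmul p x) *v horiz g)
        \<le> 4 * M * (2 * r) powr \<alpha> * norm (horiz g) + 4 * M * \<bar>vert g\<bar> powr ((1 + \<alpha>) / 2)"
      by (simp add: algebra_simps)
    have "d p (hmul p x) \<le> 1" "d p p \<le> 1"
      using dx pos r(1) d_eq_0_iff[of p p] by auto
    then have "norm (hgrad F (hmul p x) - A) \<le> L * d (hmul p x) p powr \<alpha>"
      unfolding A_def by (rule hgrad_holder)
    also have "\<dots> \<le> L * (c_up * (r + sqrt r)) powr \<alpha>"
      unfolding d_commute[of _ p] using dx alpha_pos L_nonneg d_nonneg
      by (intro mult_left_mono powr_mono2) auto
    finally have "norm ((hgrad F (hmul p x) - A) *v horiz g) \<le> L * (c_up * (r + sqrt r)) powr \<alpha> * norm (horiz g)"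
      by (rule order.trans[OF norm_matrix_vector_mult_le mult_right_mono]) simp
    from norm_triangle_mono[OF T this]
    have S: "norm (F (hmul p y) - F (hmul p x) - A *v horiz g)
        \<le> (4 * M * (2 * r) powr \<alpha> + L * (c_up * (r + sqrt r)) powr \<alpha>) * norm (horiz g)
          + 4 * M * \<bar>vert g\<bar> powr ((1 + \<alpha>) / 2)"
      by (simp add: matrix_vector_mult_diff_rdistrib algebra_simps)
    have "B *v F (hmul p y) - B *v F (hmul p x) - horiz g
        = B *v (F (hmul p y) - F (hmul p x) - A *v horiz g)"
      by (simp add: BA matrix_vector_mult_diff_distrib)
    also have "norm \<dots> \<le> norm B * norm (F (hmul p y) - F (hmul p x) - A *v horiz g)"
      by (rule norm_matrix_vector_mult_le)
    also have "\<dots> \<le> norm B * ((4 * M * (2 * r) powr \<alpha> + L * (c_up * (r + sqrt r)) powr \<alpha>) * norm (horiz g)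
          + 4 * M * \<bar>vert g\<bar> powr ((1 + \<alpha>) / 2))"
      by (rule mult_left_mono[OF S norm_ge_zero])
    also have "\<dots> = ?v r * norm (horiz g) + norm B * (4 * M) * \<bar>vert g\<bar> powr ((1 + \<alpha>) / 2)"
      by (simp add: algebra_simps)
    also have "\<dots> \<le> 1/2 * norm (horiz g) + C * \<bar>vert g\<bar> powr ((1 + \<alpha>) / 2)"
      using r(2) by (intro add_mono mult_right_mono) (auto simp: C_def)
    finally show "norm (B *v F (hmul p y) - B *v F (hmul p x) - (horiz y - horiz x))
        \<le> norm (horiz y - horiz x) / 2 + C * \<bar>vinc x y\<bar> powr ((1 + \<alpha>) / 2)"
      by (simp add: g)
  qed
  then show ?thesis
    unfolding A_def B_def by blast
qed

end

section \<open>Solutions of the level set equation\<close>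

text \<open>A real supremum is informative only for a bounded nonempty set; the a priori bound and
  two distinct points supply this.\<close>

lemma holder_norm_bounds:
  assumes bd: "\<And>s t. s \<in> I \<Longrightarrow> t \<in> I \<Longrightarrow> norm (f t - f s) \<le> \<rho> * \<bar>t - s\<bar> powr \<beta>"
    and I: "a \<in> I" "b \<in> I" "a \<noteq> b"
  shows holder_norm_le: "holder_norm \<beta> I f \<le> \<rho>"
    and holder_norm_nonneg: "0 \<le> holder_norm \<beta> I f"
    and le_holder_norm: "s \<in> I \<Longrightarrow> t \<in> I \<Longrightarrow> norm (f t - f s) \<le> holder_norm \<beta> I f * \<bar>t - s\<bar> powr \<beta>"
proof -
  let ?S = "{norm (f t - f s) / \<bar>t - s\<bar> powr \<beta> | s t. s \<in> I \<and> t \<in> I \<and> s \<noteq> t}"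
  have le: "z \<le> \<rho>" if "z \<in> ?S" for z
    using that bd by (auto simp: divide_le_eq)
  have ne: "?S \<noteq> {}"
    using I by blast
  show "holder_norm \<beta> I f \<le> \<rho>"
    unfolding holder_norm_def by (rule cSup_least[OF ne le])
  have up: "norm (f t - f s) / \<bar>t - s\<bar> powr \<beta> \<le> holder_norm \<beta> I f" if "s \<in> I" "t \<in> I" "s \<noteq> t" for s t
    unfolding holder_norm_def by (rule cSup_upper[OF _ bdd_aboveI[OF le]]) (use that in blast)
  show "0 \<le> holder_norm \<beta> I f"
    by (rule order.trans[OF _ up[OF I]]) simp
  show "norm (f t - f s) \<le> holder_norm \<beta> I f * \<bar>t - s\<bar> powr \<beta>" if "s \<in> I" "t \<in> I"
    using up[of s t] that by (cases "s = t") (auto simp: divide_le_eq)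
qed

lemma holder_norm2_le:
  assumes "\<And>s t. s \<in> I \<Longrightarrow> t \<in> I \<Longrightarrow> \<bar>E s t\<bar> \<le> c * \<bar>t - s\<bar> powr \<beta>"
    and I: "a \<in> I" "b \<in> I" "a \<noteq> b"
  shows "holder_norm2 \<beta> I E \<le> c"
proof -
  have "{\<bar>E s t\<bar> / \<bar>t - s\<bar> powr \<beta> | s t. s \<in> I \<and> t \<in> I \<and> s \<noteq> t} \<noteq> {}"
    using I by blast
  then show ?thesis
    unfolding holder_norm2_def by (rule cSup_least) (use assms(1) in \<open>auto simp: divide_le_eq\<close>)
qed

text \<open>Increments of order above one force the derivative to vanish.\<close>

lemma superlinear_increment_constant:
  fixes D :: "real \<Rightarrow> real"
  assumes "convex I" "0 < \<alpha>"
    and bd: "\<And>s t. s \<in> I \<Longrightarrow> t \<in> I \<Longrightarrow> \<bar>D t - D s\<bar> \<le> C * \<bar>t - s\<bar> powr (1 + \<alpha>)"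
  shows "\<exists>c. \<forall>t\<in>I. D t = c"
proof (rule has_field_derivative_zero_constant[OF \<open>convex I\<close>])
  fix s assume s: "s \<in> I"
  have "((\<lambda>t. C * \<bar>t - s\<bar> powr \<alpha>) \<longlongrightarrow> C * \<bar>s - s\<bar> powr \<alpha>) (at s within I)"
    using \<open>0 < \<alpha>\<close> by (intro tendsto_intros tendsto_powr'[OF _ tendsto_const]) auto
  then have lim: "((\<lambda>t. C * \<bar>t - s\<bar> powr \<alpha>) \<longlongrightarrow> 0) (at s within I)"
    by simp
  have "norm ((D t - D s) / (t - s)) \<le> C * \<bar>t - s\<bar> powr \<alpha>" if "t \<in> I" "t \<noteq> s" for t
  proof -
    have "\<bar>D t - D s\<bar> \<le> C * \<bar>t - s\<bar> powr \<alpha> * \<bar>t - s\<bar>"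
      using bd[OF s that(1)] by (simp add: powr_add powr_one mult_ac)
    then show ?thesis
      using that(2) by (simp add: divide_le_eq)
  qed
  then have "\<forall>\<^sub>F t in at s within I. norm ((D t - D s) / (t - s)) \<le> C * \<bar>t - s\<bar> powr \<alpha>"
    by (simp add: eventually_at_filter)
  then show "(D has_field_derivative 0) (at s within I)"
    unfolding has_field_derivative_iff using lim by (rule Lim_null_comparison)
qed

text \<open>The limit in the product space comes without continuity; the increment bounds supply it,
  first horizontally, then vertically through \<open>vert_eq_vinc\<close>.\<close>

lemma vertical_curve_continuous:
  assumes "0 < \<alpha>"
    and H: "\<And>s t. s \<in> I \<Longrightarrow> t \<in> I \<Longrightarrow> norm (horiz (\<gamma> t) - horiz (\<gamma> s)) \<le> N * \<bar>t - s\<bar> powr ((1 + \<alpha>) / 2)"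
    and E: "\<And>s t. s \<in> I \<Longrightarrow> t \<in> I \<Longrightarrow> \<bar>vinc (\<gamma> s) (\<gamma> t) - (t - s)\<bar> \<le> C * \<bar>t - s\<bar> powr (1 + \<alpha>)"
  shows "continuous_on I \<gamma>"
proof (rule continuous_on_heisI)
  have small: "((\<lambda>t. c * \<bar>t - s\<bar> powr b) \<longlongrightarrow> 0) (at s within I)" if "0 < b" for b c s :: real
  proof -
    have "((\<lambda>t. c * \<bar>t - s\<bar> powr b) \<longlongrightarrow> c * \<bar>s - s\<bar> powr b) (at s within I)"
      using that by (intro tendsto_intros tendsto_powr'[OF _ tendsto_const]) auto
    then show ?thesis
      by simp
  qed
  have h: "((\<lambda>t. horiz (\<gamma> t)) \<longlongrightarrow> horiz (\<gamma> s)) (at s within I)" if s: "s \<in> I" for s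
  proof -
    have "((\<lambda>t. horiz (\<gamma> t) - horiz (\<gamma> s)) \<longlongrightarrow> 0) (at s within I)"
      using assms(1) by (intro Lim_null_comparison[OF _ small[of "(1 + \<alpha>) / 2" N]])
        (auto simp: eventually_at_filter s intro!: always_eventually H)
    then show ?thesis
      by (simp add: Lim_null[symmetric])
  qed
  then show "continuous_on I (\<lambda>t. horiz (\<gamma> t))"
    by (simp add: continuous_on_def)
  show "continuous_on I (\<lambda>t. vert (\<gamma> t))"
    unfolding continuous_on_def
  proof
    fix s assume s: "s \<in> I"
    have "((\<lambda>t. vinc (\<gamma> s) (\<gamma> t) - (t - s)) \<longlongrightarrow> 0) (at s within I)"
      using assms(1) by (intro Lim_null_comparison[OF _ small[of "1 + \<alpha>" C]])
        (auto simp: eventually_at_filter s intro!: always_eventually E)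
    then have "((\<lambda>t. vert (\<gamma> s) + ((vinc (\<gamma> s) (\<gamma> t) - (t - s)) + (t - s))
        + wedge (horiz (\<gamma> s)) (horiz (\<gamma> t) - horiz (\<gamma> s)))
      \<longlongrightarrow> vert (\<gamma> s) + (0 + (s - s)) + wedge (horiz (\<gamma> s)) (horiz (\<gamma> s) - horiz (\<gamma> s))) (at s within I)"
      unfolding wedge_def by (intro tendsto_intros h[OF s])
    then show "((\<lambda>t. vert (\<gamma> t)) \<longlongrightarrow> vert (\<gamma> s)) (at s within I)"
      using vert_eq_vinc[of "\<gamma> _" "\<gamma> s", symmetric] by (simp add: wedge_def)
  qed
qed

text \<open>Any two functions whose increments agree with the germ up to order \<open>1 + \<alpha> > 1\<close>
  differ by a constant, so the sewing constant applies to the vertical component at hand.\<close>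

lemma vertical_error_le_sewing:
  assumes sew: "sewing_const TYPE(real) \<alpha> \<kappa>" and "0 < \<alpha>"
    and I: "is_interval I" and cont: "continuous_on I \<gamma>" and "0 \<le> N"
    and H: "\<And>s t. s \<in> I \<Longrightarrow> t \<in> I \<Longrightarrow> norm (horiz (\<gamma> t) - horiz (\<gamma> s)) \<le> N * \<bar>t - s\<bar> powr ((1 + \<alpha>) / 2)"
    and E: "\<And>s t. s \<in> I \<Longrightarrow> t \<in> I \<Longrightarrow> \<bar>vinc (\<gamma> s) (\<gamma> t) - (t - s)\<bar> \<le> C * \<bar>t - s\<bar> powr (1 + \<alpha>)"
    and st: "s \<in> I" "t \<in> I"
  shows "\<bar>vinc (\<gamma> s) (\<gamma> t) - (t - s)\<bar> \<le> \<kappa> * N\<^sup>2 * \<bar>t - s\<bar> powr (1 + \<alpha>)"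
proof -
  \<comment> \<open>The germ whose difference from the increment of \<open>vert\<close> is exactly
    the error term; its additivity defect is a wedge of two horizontal increments, hence
    N^2.\<close>
  define A where "A s t = (t - s) + wedge (horiz (\<gamma> s)) (horiz (\<gamma> t))" for s t
  have vert_A: "vert (\<gamma> t) - vert (\<gamma> s) - A s t = vinc (\<gamma> s) (\<gamma> t) - (t - s)" for s t
    by (simp add: A_def vinc_eq)
  have c1: "continuous_on (I \<times> I) (\<lambda>z. \<gamma> (fst z))" and c2: "continuous_on (I \<times> I) (\<lambda>z. \<gamma> (snd z))"
    by (auto intro!: continuous_on_compose2[OF cont] continuous_intros)
  have "continuous_on (I \<times> I) (\<lambda>(s, t). A s t)"
    unfolding A_def case_prod_unfold by (intro continuous_intros continuous_on_wedge continuous_on_horiz c1 c2)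
  moreover have "norm (A s t - A s u - A u t) \<le> N\<^sup>2 * \<bar>t - s\<bar> powr (1 + \<alpha>)"
    if "s \<in> I" "u \<in> I" "t \<in> I" "s \<le> u" "u \<le> t" for s u t
  proof -
    let ?b = "\<lambda>s t. N * \<bar>t - s\<bar> powr ((1 + \<alpha>) / 2)"
    have "\<bar>A s t - A s u - A u t\<bar> = \<bar>wedge (horiz (\<gamma> u) - horiz (\<gamma> s)) (horiz (\<gamma> t) - horiz (\<gamma> u))\<bar>"
      by (simp add: A_def wedge_def algebra_simps)
    also have "\<dots> \<le> norm (horiz (\<gamma> u) - horiz (\<gamma> s)) * norm (horiz (\<gamma> t) - horiz (\<gamma> u))"
      by (rule abs_wedge_le)
    also have "\<dots> \<le> ?b s t * ?b s t"
    proof (intro mult_mono)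
      have "?b s u \<le> ?b s t" "?b u t \<le> ?b s t"
        using that \<open>0 \<le> N\<close> \<open>0 < \<alpha>\<close> by (auto intro!: mult_left_mono powr_mono2)
      then show "norm (horiz (\<gamma> u) - horiz (\<gamma> s)) \<le> ?b s t" "norm (horiz (\<gamma> t) - horiz (\<gamma> u)) \<le> ?b s t"
        using H[OF that(1,2)] H[OF that(2,3)] by linarith+
    qed (use \<open>0 \<le> N\<close> in auto)
    also have "\<dots> = N\<^sup>2 * \<bar>t - s\<bar> powr (1 + \<alpha>)"
      by (simp add: power2_eq_square powr_half_square[symmetric])
    finally show ?thesis
      by simp
  qed
  ultimately obtain f :: "real \<Rightarrow> real" where
    f: "\<And>s t. s \<in> I \<Longrightarrow> t \<in> I \<Longrightarrow> s \<le> t \<Longrightarrow> norm (f t - f s - A s t) \<le> \<kappa> * N\<^sup>2 * \<bar>t - s\<bar> powr (1 + \<alpha>)"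
    using sew[unfolded sewing_const_def, rule_format, of I A "N\<^sup>2"] I by blast
  define D where "D t = f t - vert (\<gamma> t)" for t
  have D: "\<bar>D t - D s\<bar> \<le> (\<kappa> * N\<^sup>2 + C) * \<bar>t - s\<bar> powr (1 + \<alpha>)" if "s \<in> I" "t \<in> I" "s \<le> t" for s t
  proof -
    have "D t - D s = (f t - f s - A s t) - (vinc (\<gamma> s) (\<gamma> t) - (t - s))"
      unfolding D_def vert_A[symmetric] by simp
    then show ?thesis
      using f[OF that] E[OF that(1,2)] unfolding distrib_right by simp
  qed
  have "\<bar>D t - D s\<bar> \<le> (\<kappa> * N\<^sup>2 + C) * \<bar>t - s\<bar> powr (1 + \<alpha>)" if "s \<in> I" "t \<in> I" for s t
    using D[of s t] D[of t s] that by (cases "s \<le> t") (auto simp: abs_minus_commute)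
  then obtain c where c: "\<And>t. t \<in> I \<Longrightarrow> D t = c"
    using superlinear_increment_constant[of I \<alpha> D] I \<open>0 < \<alpha>\<close> is_interval_convex_1 by metis
  \<comment> \<open>As D is constant, f and the vertical coordinate have equal increments, so the
    sewing bound for f replaces the crude constant C.\<close>
  have le: "\<bar>vinc (\<gamma> s) (\<gamma> t) - (t - s)\<bar> \<le> \<kappa> * N\<^sup>2 * \<bar>t - s\<bar> powr (1 + \<alpha>)" if "s \<in> I" "t \<in> I" "s \<le> t" for s t
    using f[OF that] c[OF that(1)] c[OF that(2)] unfolding vert_A[symmetric] D_def by simp
  show ?thesis
    using le[of s t] le[of t s] st vinc_commute[of "\<gamma> s" "\<gamma> t"] by (cases "s \<le> t") (auto simp: abs_minus_commute)
qed

text \<open>F p cancels in the remainder difference, the inverse gradient times F is constant along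
  the curve, and what is left is minus the horizontal increment.\<close>

lemma LSDE_solution_level_curve:
  assumes inv: "invertible (hgrad F p)" and "0 < \<alpha>"
    and level: "\<And>t. t \<in> I \<Longrightarrow> matrix_inv (hgrad F p) *v F (\<gamma> t) = v"
    and H: "\<And>s t. s \<in> I \<Longrightarrow> t \<in> I \<Longrightarrow> norm (horiz (\<gamma> t) - horiz (\<gamma> s)) \<le> N * \<bar>t - s\<bar> powr ((1 + \<alpha>) / 2)"
    and E: "\<And>s t. s \<in> I \<Longrightarrow> t \<in> I \<Longrightarrow> \<bar>vinc (\<gamma> s) (\<gamma> t) - (t - s)\<bar> \<le> C * \<bar>t - s\<bar> powr (1 + \<alpha>)"
  shows "LSDE_solution \<alpha> F p I \<gamma>"
  unfolding LSDE_solution_def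
proof (intro conjI ballI)
  show "continuous_on I \<gamma>"
    by (rule vertical_curve_continuous[OF \<open>0 < \<alpha>\<close> H E])
  show "\<exists>C. \<forall>s\<in>I. \<forall>t\<in>I. s \<noteq> t \<longrightarrow> \<bar>Erem \<gamma> s t\<bar> \<le> C * \<bar>t - s\<bar> powr (1 + \<alpha>)"
    using E by (auto simp: Erem_def vinc_def)
  fix s t assume "s \<in> I" "t \<in> I"
  let ?A = "hgrad F p" and ?B = "matrix_inv (hgrad F p)"
  have "Rem F p (\<gamma> t) - Rem F p (\<gamma> s) = F (\<gamma> t) - F (\<gamma> s) - ?A *v (horiz (\<gamma> t) - horiz (\<gamma> s))"
    by (simp add: Rem_def matrix_vector_mult_diff_distrib matrix_vector_right_distrib)
  then have "?B *v (Rem F p (\<gamma> t) - Rem F p (\<gamma> s))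
      = ?B *v F (\<gamma> t) - ?B *v F (\<gamma> s) - (?B ** ?A) *v (horiz (\<gamma> t) - horiz (\<gamma> s))"
    by (simp add: matrix_vector_mult_diff_distrib matrix_vector_mul_assoc)
  then show "horiz (hmul (hinv (\<gamma> s)) (\<gamma> t)) = - (?B *v (Rem F p (\<gamma> t) - Rem F p (\<gamma> s)))"
    using level \<open>s \<in> I\<close> \<open>t \<in> I\<close> by (simp add: matrix_inv_mult_left[OF inv])
qed

text \<open>The explicit Hoelder inequality accompanies the seminorm bound because a real
  \<open>Sup\<close> of an unbounded set says nothing; for the error term
  \<open>LSDE_solution\<close> contains the corresponding bound.\<close>

theorem mainTheorem2:
  fixes d :: "heis \<Rightarrow> heis \<Rightarrow> real" and \<alpha> \<kappa> :: real
    and F :: "heis \<Rightarrow> real^2" and p :: heis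
  assumes "heis_distance d"
    and "0 < \<alpha>" and "\<alpha> \<le> 1"
    and "\<kappa> > 0" and "sewing_const TYPE(real) \<alpha> \<kappa>" and "sewing_const TYPE(real^2) \<alpha> \<kappa>"
    and "C1alpha_h d \<alpha> F"
    and "nondegenerate F p"
  shows "\<exists>\<delta>0 \<epsilon>0 \<rho>0. \<delta>0 > 0 \<and> \<epsilon>0 > 0 \<and> \<rho>0 > 0 \<and>
    (\<forall>q. d p q < \<epsilon>0 \<longrightarrow>
      (\<exists>\<gamma>. LSDE_solution \<alpha> F p {-\<delta>0..\<delta>0} \<gamma> \<and> inj_on \<gamma> {-\<delta>0..\<delta>0} \<and> \<gamma> 0 = q \<and>
         (\<forall>s\<in>{-\<delta>0..\<delta>0}. \<forall>t\<in>{-\<delta>0..\<delta>0}.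
            norm (horiz (\<gamma> t) - horiz (\<gamma> s)) \<le> \<rho>0 * \<bar>t - s\<bar> powr ((1 + \<alpha>) / 2)) \<and>
         holder_norm ((1 + \<alpha>) / 2) {-\<delta>0..\<delta>0} (\<lambda>t. horiz (\<gamma> t)) \<le> \<rho>0 \<and>
         holder_norm2 (1 + \<alpha>) {-\<delta>0..\<delta>0} (Erem \<gamma>)
           \<le> \<kappa> * (holder_norm ((1 + \<alpha>) / 2) {-\<delta>0..\<delta>0} (\<lambda>t. horiz (\<gamma> t)))\<^sup>2 \<and>
         \<kappa> * (holder_norm ((1 + \<alpha>) / 2) {-\<delta>0..\<delta>0} (\<lambda>t. horiz (\<gamma> t)))\<^sup>2 \<le> \<kappa> * \<rho>0\<^sup>2))"
proof -
  interpret homogeneous_distance d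
    by (unfold_locales) (rule assms(1))
  have inv: "invertible (hgrad F p)"
    using assms(8) by (simp add: nondegenerate_def)
  have "d 0 x \<le> d 0 p + 1" if "d p x \<le> 1" for x
    using that d_triangle[of 0 x p] by simp
  then have "d_bounded d {x. d p x \<le> 1}"
    unfolding d_bounded_def by blast
  then obtain L where L: "\<forall>x\<in>{x. d p x \<le> 1}. \<forall>y\<in>{x. d p x \<le> 1}. norm (hgrad F x - hgrad F y) \<le> L * d x y powr \<alpha>"
    using assms(7) unfolding C1alpha_h_def by blast
  interpret horizontal_holder d F p \<alpha> "\<bar>L\<bar>"
  proof unfold_locales
    fix x y assume "d p x \<le> 1" "d p y \<le> 1"
    then have "norm (hgrad F x - hgrad F y) \<le> L * d x y powr \<alpha>"
      using L by blast
    also have "\<dots> \<le> \<bar>L\<bar> * d x y powr \<alpha>"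
      by (intro mult_right_mono) auto
    finally show "norm (hgrad F x - hgrad F y) \<le> \<bar>L\<bar> * d x y powr \<alpha>" .
  qed (use assms(2,7) in \<open>auto simp: C1alpha_h_def\<close>)
  \<comment> \<open>Left translation moves p to the identity, where the boxes are centred, and
    preserves horizontal and vertical increments.\<close>
  define G where "G x = matrix_inv (hgrad F p) *v F (hmul p x)" for x
  obtain r C where "level_estimate G r C \<alpha>"
    using exists_level_estimate[OF inv assms(3)] unfolding G_def by blast
  then obtain \<delta> where "level_time G r C \<alpha> \<delta>"
    using level_estimate.exists_level_time by blast
  then interpret level_time G r C \<alpha> \<delta> .
  obtain c where c: "0 < c" "\<And>x. hn x \<le> c * d 0 x"
    using exists_hn_le_d_0 by blast
  \<comment> \<open>Makes the gauge of p^-1 q at most r/4 and at most 1; the latter bounds the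
    vertical coordinate by the gauge instead of its square.\<close>
  define \<epsilon> where "\<epsilon> = min 1 (r / 4) / c"
  let ?I = "{- \<delta>..\<delta>}"
  have I: "- \<delta> \<in> ?I" "\<delta> \<in> ?I" "- \<delta> \<noteq> \<delta>"
    using delta_pos by auto
  have "\<exists>\<gamma>. LSDE_solution \<alpha> F p ?I \<gamma> \<and> inj_on \<gamma> ?I \<and> \<gamma> 0 = q \<and>
         (\<forall>s\<in>?I. \<forall>t\<in>?I. norm (horiz (\<gamma> t) - horiz (\<gamma> s)) \<le> 4 * C * \<bar>t - s\<bar> powr ((1 + \<alpha>) / 2)) \<and>
         holder_norm ((1 + \<alpha>) / 2) ?I (\<lambda>t. horiz (\<gamma> t)) \<le> 4 * C \<and>
         holder_norm2 (1 + \<alpha>) ?I (Erem \<gamma>) \<le> \<kappa> * (holder_norm ((1 + \<alpha>) / 2) ?I (\<lambda>t. horiz (\<gamma> t)))\<^sup>2 \<and>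
         \<kappa> * (holder_norm ((1 + \<alpha>) / 2) ?I (\<lambda>t. horiz (\<gamma> t)))\<^sup>2 \<le> \<kappa> * (4 * C)\<^sup>2"
    if q: "d p q < \<epsilon>" for q
  proof -
    define q' where "q' = hmul (hinv p) q"
    have "c * d 0 q' \<le> min 1 (r / 4)"
      using q c(1) d_eq[of p q] unfolding \<epsilon>_def q'_def by (simp add: less_divide_eq mult.commute)
    then have hq: "hn q' \<le> 1" "hn q' \<le> r / 4"
      using c(2)[of q'] by linarith+
    have "\<bar>vert q'\<bar> \<le> hn q' * hn q'"
      using abs_vert_le_hn[of q'] by (simp add: power2_eq_square)
    also have "\<dots> \<le> hn q' * 1"
      by (rule mult_left_mono[OF hq(1) hn_nonneg])
    finally have "\<bar>vert q'\<bar> \<le> hn q'"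
      by simp
    then have "q' \<in> hbox (r / 4)"
      using hq(2) real_sqrt_ge_zero[OF abs_ge_zero, of "vert q'"] unfolding hbox_def hn_def mem_Collect_eq by linarith
    then obtain g where g0: "g 0 = q'" and g: "\<And>t. g t \<in> hbox r" "\<And>t. G (g t) = G q'"
      and gE: "\<And>s t. s \<in> ?I \<Longrightarrow> t \<in> ?I \<Longrightarrow> \<bar>vinc (g s) (g t) - (t - s)\<bar> \<le> K * \<bar>t - s\<bar> powr (1 + \<alpha>)"
      using exists_level_curve by blast
    define \<gamma> where "\<gamma> t = hmul p (g t)" for t
    \<comment> \<open>An error of at most half the elapsed time yields both the factor 2 for
      \<open>horiz_le_time\<close> and injectivity.\<close>
    have half: "K * \<bar>t - s\<bar> powr (1 + \<alpha>) \<le> 1/2 * \<bar>t - s\<bar>" if "s \<in> ?I" "t \<in> ?I" for s t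
    proof -
      have "K * \<bar>t - s\<bar> powr \<alpha> \<le> 1/2"
        using that by (intro delta_small) auto
      from mult_right_mono[OF this abs_ge_zero[of "t - s"]] show ?thesis
        by (simp add: powr_add powr_one mult_ac)
    qed
    have E: "\<bar>vinc (\<gamma> s) (\<gamma> t) - (t - s)\<bar> \<le> K * \<bar>t - s\<bar> powr (1 + \<alpha>)" if "s \<in> ?I" "t \<in> ?I" for s t
      using gE[OF that] by (simp add: \<gamma>_def)
    have H: "norm (horiz (\<gamma> t) - horiz (\<gamma> s)) \<le> 4 * C * \<bar>t - s\<bar> powr ((1 + \<alpha>) / 2)" if "s \<in> ?I" "t \<in> ?I" for s t
    proof -
      have "\<bar>vinc (g s) (g t)\<bar> \<le> 2 * \<bar>t - s\<bar>"
        using gE[OF that] half[OF that] abs_triangle_ineq2[of "vinc (g s) (g t)" "t - s"] abs_ge_zero[of "t - s"]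
        by argo
      from horiz_le_time[OF g(1) g(1) _ this] show ?thesis
        by (simp add: \<gamma>_def g(2))
    qed
    \<comment> \<open>The seminorm itself, not its bound 4 C, enters the sewing estimate; this gives
      the sharp quadratic bound.\<close>
    define N where "N = holder_norm ((1 + \<alpha>) / 2) ?I (\<lambda>t. horiz (\<gamma> t))"
    note N = holder_norm_bounds[of ?I "\<lambda>t. horiz (\<gamma> t)", OF H I, folded N_def]
    have sol: "LSDE_solution \<alpha> F p ?I \<gamma>"
      by (rule LSDE_solution_level_curve[OF inv assms(2) _ H E, where v = "G q'"])
        (use g(2) in \<open>auto simp: G_def \<gamma>_def\<close>)
    then have cont: "continuous_on ?I \<gamma>"
      by (simp add: LSDE_solution_def)
    have "inj_on \<gamma> ?I"
    proof (rule inj_onI)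
      fix s t assume st: "s \<in> ?I" "t \<in> ?I" "\<gamma> s = \<gamma> t"
      then have "\<bar>t - s\<bar> \<le> 1/2 * \<bar>t - s\<bar>"
        using E[OF st(1,2)] half[OF st(1,2)] by simp
      then show "s = t"
        by simp
    qed
    moreover have "\<gamma> 0 = q"
      by (simp add: \<gamma>_def g0 q'_def)
    moreover have "\<bar>Erem \<gamma> s t\<bar> \<le> \<kappa> * N\<^sup>2 * \<bar>t - s\<bar> powr (1 + \<alpha>)" if "s \<in> ?I" "t \<in> ?I" for s t
      unfolding Erem_def vinc_def[symmetric]
      by (rule vertical_error_le_sewing[OF assms(5,2) is_interval_cc cont N(2) N(3) E that])
    then have "holder_norm2 (1 + \<alpha>) ?I (Erem \<gamma>) \<le> \<kappa> * N\<^sup>2"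
      by (rule holder_norm2_le) (use I in auto)
    moreover have "\<kappa> * N\<^sup>2 \<le> \<kappa> * (4 * C)\<^sup>2"
      using N(1,2) assms(4) by (intro mult_left_mono power_mono) auto
    ultimately show ?thesis
      using sol H N(1) unfolding N_def by blast
  qed
  moreover have "0 < \<epsilon>"
    using c(1) r_pos by (simp add: \<epsilon>_def)
  ultimately show ?thesis
    using delta_pos C_pos by (intro exI[of _ \<delta>] exI[of _ \<epsilon>] exI[of _ "4 * C"]) auto
qed

end
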